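(* Let $V_3^h$ be the cubic finite element space associated with the element $S_3^h=(T,\mathbb{P}_3(T),\Sigma_T)$ on the triangulation $\mathcal{T}_h$, every triangle of which has two type I edges. Then there holds the inclusion $V_3^h\subset V$.
   Context: $\Omega\subset\mathbf{R}^2$ is a bounded domain and $\mathcal{T}_h$ is a quasi-uniform triangulation of $\Omega$ such that every triangle has two type I edges. With $\Box v:=\partial_{xx}v-\partial_{yy}v$ (in the sense of distributions), $V:=\{v\in H^1(\Omega):\ \Box v\in L^2(\Omega)\}$. For an edge $e$ with unit normal $n=(n_1,n_2)$ and unit tangent $\tau$, put $\bar n:=(n_1,-n_2)$ and $\partial_{\bar n}v:=\nabla v\cdot\bar n$. The edge $e$ is type I if $\bar n=\pm\tau$ (equivalently, $e$ makes an angle $\pm\pi/4$ with the $x$-axis), and type II otherwise. Let $T$ be a triangle with vertices $a_1,a_2,a_3$; $e_i$ is the edge of $T$ not containing $a_i$, $b_i$ is the midpoint of $e_i$, and $a_{ij}:=\frac12(a_i+a_j)$. Label $T$ so that $e_3$ is its type II edge ($e_1,e_2$ are type I). The element $S_3^h$ has polynomial space $\mathbb{P}_3(T)$ (polynomials of degree at most 3) and degrees of freedom $$\Sigma_T:\quad v(a_i)\ (1\le i\le 3);\quad v(a_{i3})\ (1\le i\le 2);\quad \nabla v(a_i)\cdot(a_j-a_i)\ (1\le i\le 2,\ 1\le j\le 3,\ j\ne i);\quad \partial_{\bar n}v(b_3),$$ where $\bar n$ in the last one is taken with respect to $e_3$. The space $V_3^h$ consists of all $v$ with $v|_T\in\mathbb{P}_3(T)$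 for all $T\in\mathcal{T}_h$ that are continuous at every degree of freedom in $\Sigma_T$ for all $T\in\mathcal{T}_h$; that is, for each $T$ and each functional in $\Sigma_T$, located at a node $p$, the functional (with its fixed direction, if it is a derivative) takes the same value on $v|_{T'}$ for all triangles $T'\in\mathcal{T}_h$ containing $p$. *)

theory Defs
  imports "HOL-Analysis.Analysis"
begin

section \<open>Derivatives, test functions and polynomials in the plane\<close>

definition partial :: "2 \<Rightarrow> (real^2 \<Rightarrow> real) \<Rightarrow> real^2 \<Rightarrow> real" where
  "partial i f x = frechet_derivative f (at x) (axis i 1)"

definition grad :: "(real^2 \<Rightarrow> real) \<Rightarrow> real^2 \<Rightarrow> real^2" where
  "grad f x = (\<chi> i. partial i f x)"

definition box_op :: "(real^2 \<Rightarrow> real) \<Rightarrow> real^2 \<Rightarrow> real" where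
  "box_op f x = partial 1 (partial 1 f) x - partial 2 (partial 2 f) x"

text \<open>\<open>C_k k f\<close>: all partial derivatives of \<open>f\<close> of order at most \<open>k\<close> exist and are continuous.\<close>

primrec C_k :: "nat \<Rightarrow> (real^2 \<Rightarrow> real) \<Rightarrow> bool" where
  "C_k 0 f \<longleftrightarrow> continuous_on UNIV f"
| "C_k (Suc k) f \<longleftrightarrow> (\<forall>x. f differentiable (at x)) \<and> (\<forall>i. C_k k (partial i f))"

definition test_functions :: "(real^2) set \<Rightarrow> (real^2 \<Rightarrow> real) set" where
  "test_functions \<Omega> =
     {\<phi>. (\<forall>k. C_k k \<phi>) \<and> compact (closure {x. \<phi> x \<noteq> 0}) \<and> closure {x. \<phi> x \<noteq> 0} \<subseteq> \<Omega>}"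

definition poly_space :: "nat \<Rightarrow> (real^2 \<Rightarrow> real) set" where
  "poly_space k =
     {p. \<exists>c :: nat \<Rightarrow> nat \<Rightarrow> real. \<forall>x. p x = (\<Sum>(i, j) \<in> {(i, j). i + j \<le> k}. c i j * x$1 ^ i * x$2 ^ j)}"


section \<open>The spaces \<open>L\<^sup>2\<close>, \<open>H\<^sup>1\<close> and \<open>V\<close>\<close>

text \<open>
  Elements of these spaces are represented by functions on the whole plane; only the almost
  everywhere values on \<open>\<Omega>\<close> matter, so membership is invariant under a.e. equality on \<open>\<Omega>\<close>.
\<close>

definition L2 :: "(real^2) set \<Rightarrow> (real^2 \<Rightarrow> real) set" where
  "L2 \<Omega> = {v \<in> borel_measurable (lebesgue_on \<Omega>). integrable (lebesgue_on \<Omega>) (\<lambda>x. (v x)\<^sup>2)}"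

definition weak_partial :: "(real^2) set \<Rightarrow> 2 \<Rightarrow> (real^2 \<Rightarrow> real) \<Rightarrow> (real^2 \<Rightarrow> real) \<Rightarrow> bool" where
  "weak_partial \<Omega> i v g \<longleftrightarrow>
     (\<forall>\<phi> \<in> test_functions \<Omega>.
        (LINT x|lebesgue_on \<Omega>. v x * partial i \<phi> x) = - (LINT x|lebesgue_on \<Omega>. g x * \<phi> x))"

definition weak_box :: "(real^2) set \<Rightarrow> (real^2 \<Rightarrow> real) \<Rightarrow> (real^2 \<Rightarrow> real) \<Rightarrow> bool" where
  "weak_box \<Omega> v w \<longleftrightarrow>
     (\<forall>\<phi> \<in> test_functions \<Omega>.
        (LINT x|lebesgue_on \<Omega>. v x * box_op \<phi> x) = (LINT x|lebesgue_on \<Omega>. w x * \<phi> x))"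

definition H1 :: "(real^2) set \<Rightarrow> (real^2 \<Rightarrow> real) set" where
  "H1 \<Omega> = {v \<in> L2 \<Omega>. \<forall>i. \<exists>g \<in> L2 \<Omega>. weak_partial \<Omega> i v g}"

definition V_space :: "(real^2) set \<Rightarrow> (real^2 \<Rightarrow> real) set" where
  "V_space \<Omega> = {v \<in> H1 \<Omega>. \<exists>w \<in> L2 \<Omega>. weak_box \<Omega> v w}"


section \<open>Type I and type II edges\<close>

definition bar :: "real^2 \<Rightarrow> real^2" where
  "bar n = vector [n$1, - n$2]"

text \<open>An edge is a nondegenerate segment; it has two opposite unit normals and unit tangents.\<close>

definition unit_normals :: "(real^2) set \<Rightarrow> (real^2) set" where
  "unit_normals e = {n. norm n = 1 \<and> (\<forall>x\<in>e. \<forall>y\<in>e. n \<bullet> (y - x) = 0)}"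

definition unit_tangents :: "(real^2) set \<Rightarrow> (real^2) set" where
  "unit_tangents e = {sgn (y - x) | x y. x \<in> e \<and> y \<in> e \<and> x \<noteq> y}"

definition type_I :: "(real^2) set \<Rightarrow> bool" where
  "type_I e \<longleftrightarrow> (\<exists>n \<in> unit_normals e. \<exists>\<tau> \<in> unit_tangents e. bar n = \<tau> \<or> bar n = - \<tau>)"

abbreviation type_II :: "(real^2) set \<Rightarrow> bool" where
  "type_II e \<equiv> \<not> type_I e"


section \<open>Triangulations\<close>

text \<open>
  Triangles are closed. The constant \<^const>\<open>triangulation\<close> already demands finiteness and that two
  cells meet in a common face (possibly empty), so there are no hanging nodes.
\<close>

definition triangulation_of :: "(real^2) set \<Rightarrow> (real^2) set set \<Rightarrow> bool" where
  "triangulation_of \<Omega> \<T> \<longleftrightarrow> triangulation \<T> \<and> (\<forall>T\<in>\<T>. 2 simplex T) \<and> \<Union>\<T> = closure \<Omega>"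

definition inradius :: "(real^2) set \<Rightarrow> real" where
  "inradius T = Sup {r. 0 \<le> r \<and> (\<exists>c. cball c r \<subseteq> T)}"

definition mesh_size :: "(real^2) set set \<Rightarrow> real" where
  "mesh_size \<T> = Max (diameter ` \<T>)"

text \<open>
  Quasi-uniformity with an explicit constant: a family of triangulations is quasi-uniform iff all
  its members satisfy this predicate with one common \<open>\<sigma>\<close>.
\<close>

definition quasi_uniform :: "real \<Rightarrow> (real^2) set set \<Rightarrow> bool" where
  "quasi_uniform \<sigma> \<T> \<longleftrightarrow> (\<forall>T\<in>\<T>. mesh_size \<T> \<le> \<sigma> * inradius T)"


section \<open>The element \<open>S\<^sub>3\<^sup>h\<close> and the space \<open>V\<^sub>3\<^sup>h\<close>\<close>

text \<open>Vertices are indexed by the three-element type \<open>3\<close>, whose elements are \<open>1\<close>, \<open>2\<close> and \<open>3\<close>.\<close>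

definition is_vertices :: "(real^2) set \<Rightarrow> (3 \<Rightarrow> real^2) \<Rightarrow> bool" where
  "is_vertices T a \<longleftrightarrow> inj a \<and> \<not> affine_dependent (range a) \<and> T = convex hull (range a)"

definition opp_edge :: "(3 \<Rightarrow> real^2) \<Rightarrow> 3 \<Rightarrow> (real^2) set" where
  "opp_edge a i = convex hull (a ` (- {i}))"

definition admissible_labelling :: "(real^2) set \<Rightarrow> (3 \<Rightarrow> real^2) \<Rightarrow> bool" where
  "admissible_labelling T a \<longleftrightarrow>
     is_vertices T a \<and> type_I (opp_edge a 1) \<and> type_I (opp_edge a 2) \<and> type_II (opp_edge a 3)"

text \<open>
  A degree of freedom is a pair of its node and a functional. The last one is listed for both
  choices of the unit normal of \<open>e\<^sub>3\<close>, which changes the functional only by a sign.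
\<close>

definition dofs ::
  "(3 \<Rightarrow> real^2) \<Rightarrow> ((real^2) \<times> ((real^2 \<Rightarrow> real) \<Rightarrow> real)) set" where
  "dofs a =
     {(a i, \<lambda>v. v (a i)) | i. True} \<union>
     {(midpoint (a i) (a 3), \<lambda>v. v (midpoint (a i) (a 3))) | i. i \<in> {1, 2}} \<union>
     {(a i, \<lambda>v. grad v (a i) \<bullet> (a j - a i)) | i j. i \<in> {1, 2} \<and> j \<noteq> i} \<union>
     {(midpoint (a 1) (a 2), \<lambda>v. grad v (midpoint (a 1) (a 2)) \<bullet> bar n) | n.
        n \<in> unit_normals (opp_edge a 3)}"

text \<open>
  The polynomial \<open>P T\<close> is the restriction of \<open>v\<close> to \<open>T\<close>, with its values on the boundary of \<open>T\<close>
  taken from inside. Requiring \<open>v = P T\<close> only in the interior leaves \<open>v\<close> a priori multivalued across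
  edges, so that interelement continuity comes from the degrees of freedom alone. The labelling of
  \<open>T\<close> is unique up to swapping \<open>a 1\<close> and \<open>a 2\<close>, under which \<^const>\<open>dofs\<close> is invariant.
\<close>

definition V3h :: "(real^2) set set \<Rightarrow> (real^2 \<Rightarrow> real) set" where
  "V3h \<T> = {v. \<exists>P.
     (\<forall>T\<in>\<T>. P T \<in> poly_space 3 \<and> (\<forall>x\<in>interior T. v x = P T x)) \<and>
     (\<forall>T\<in>\<T>. \<forall>a. admissible_labelling T a \<longrightarrow>
        (\<forall>(p, L)\<in>dofs a. \<forall>T'\<in>\<T>. p \<in> T' \<longrightarrow> L (P T') = L (P T)))}"

end

theory Submission
  imports Defs
begin

text \<open>
  With \<open>d = (1, 1)\<close> and \<open>d' = (1, -1)\<close> one has \<open>2 \<box> = \<partial>\<^sub>d \<partial>\<^bsub>d'\<^esub> + \<partial>\<^bsub>d'\<^esub> \<partial>\<^sub>d\<close>, and the type I edges are exactly those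
  parallel to \<open>d\<close> or \<open>d'\<close>. So it suffices to integrate by parts twice along characteristic lines
  without producing jump terms. Along a direction \<open>d\<close> there is no jump term as soon as the pieces match
  on almost every line parallel to \<open>d\<close>: the product with a test function is then Lipschitz along these
  lines, and the integral of its derivative vanishes by translation invariance. The degrees of freedom
  force the cubic pieces to match on every edge, which gives the first integration by parts. For the
  second one, \<open>\<partial>\<^sub>d v\<close> is a tangential derivative on the type I edges parallel to \<open>d\<close>, and the whole gradient
  matches on type II edges, because the derivative of \<open>v\<close> along \<open>bar n\<close> is a quadratic known at three points
  there and \<open>bar n\<close> is not tangential. The edges parallel to \<open>d'\<close> and the vertices lie on finitely many lines parallel to \<open>d'\<close>.
\<close>

section \<open>Smooth functions and polynomials in the plane\<close>

text \<open>A linear map on the plane is determined by its values on the two axes, so at points of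
  differentiability the derivative picked by \<open>frechet_derivative\<close> is the inner product
  with \<open>grad\<close>.\<close>

lemma has_derivative_grad:
  assumes "f differentiable (at x)"
  shows "(f has_derivative (\<lambda>h. grad f x \<bullet> h)) (at x)"
proof -
  have fd: "(f has_derivative frechet_derivative f (at x)) (at x)"
    using assms frechet_derivative_works by blast
  interpret bounded_linear "frechet_derivative f (at x)"
    using fd by (rule has_derivative_bounded_linear)
  have "frechet_derivative f (at x) h = grad f x \<bullet> h" for h
  proof -
    have "h = h$1 *\<^sub>R axis 1 1 + h$2 *\<^sub>R axis 2 1"
      by (simp add: vec_eq_iff forall_2 axis_def)
    then have "frechet_derivative f (at x) h =
        h$1 * frechet_derivative f (at x) (axis 1 1) + h$2 * frechet_derivative f (at x) (axis 2 1)"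
      by (metis add scale real_scaleR_def)
    then show ?thesis
      by (simp add: grad_def partial_def inner_vec_def sum_2 mult.commute)
  qed
  then have "frechet_derivative f (at x) = (\<lambda>h. grad f x \<bullet> h)" by (rule ext)
  with fd show ?thesis by simp
qed

lemma partial_eqI:
  assumes "(f has_derivative f') (at x)"
  shows "partial i f x = f' (axis i 1)"
  using assms frechet_derivative_at unfolding partial_def by metis

lemma grad_inner_eq: "grad f x \<bullet> d = d$1 * partial 1 f x + d$2 * partial 2 f x"
  by (simp add: grad_def inner_vec_def sum_2 mult.commute)

lemma C_k_Suc_imp: "C_k (Suc k) f \<Longrightarrow> C_k k f"
proof (induction k arbitrary: f)
  case 0
  then show ?case
    by (auto intro!: continuous_at_imp_continuous_on differentiable_imp_continuous_within)
next
  case (Suc k)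
  then show ?case by simp
qed

lemma C_k_continuous: "C_k k f \<Longrightarrow> continuous_on S f"
proof (induction k)
  case 0
  then show ?case by (auto intro: continuous_on_subset)
next
  case (Suc k)
  then show ?case using C_k_Suc_imp by blast
qed

lemma partial_lincomb:
  assumes "f differentiable (at x)" "g differentiable (at x)"
  shows "partial i (\<lambda>x. a * f x + b * g x) x = a * partial i f x + b * partial i g x"
proof -
  have "((\<lambda>x. a * f x + b * g x) has_derivative
      (\<lambda>h. a * (grad f x \<bullet> h) + b * (grad g x \<bullet> h))) (at x)"
    by (intro derivative_intros has_derivative_grad assms)
  from partial_eqI[OF this, of i] show ?thesis
    by (simp add: grad_def inner_axis)
qed

lemma C_k_lincomb:
  "C_k k f \<Longrightarrow> C_k k g \<Longrightarrow> C_k k (\<lambda>x. a * f x + b * g x)"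
proof (induction k arbitrary: f g)
  case 0
  then show ?case by (auto intro!: continuous_intros)
next
  case (Suc k)
  have "partial i (\<lambda>x. a * f x + b * g x) = (\<lambda>x. a * partial i f x + b * partial i g x)" for i
    using Suc.prems by (intro ext partial_lincomb) auto
  with Suc show ?case by (auto intro!: derivative_intros)
qed

lemma partial_mult:
  assumes "f differentiable (at x)" "g differentiable (at x)"
  shows "partial i (\<lambda>x. f x * g x) x = f x * partial i g x + partial i f x * g x"
proof -
  have "((\<lambda>x. f x * g x) has_derivative
      (\<lambda>h. f x * (grad g x \<bullet> h) + (grad f x \<bullet> h) * g x)) (at x)"
    by (intro has_derivative_mult has_derivative_grad assms)
  from partial_eqI[OF this, of i] show ?thesis
    by (simp add: grad_def inner_axis)
qed

lemma C_k_mult: "C_k k f \<Longrightarrow> C_k k g \<Longrightarrow> C_k k (\<lambda>x. f x * g x)"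
proof (induction k arbitrary: f g)
  case 0
  then show ?case by (auto intro!: continuous_intros)
next
  case (Suc k)
  \<comment> \<open>The factors \<open>1\<close> give the product rule the shape that
    \<open>C_k_lincomb\<close> expects.\<close>
  have eq: "partial i (\<lambda>x. f x * g x) = (\<lambda>x. 1 * (f x * partial i g x) + 1 * (partial i f x * g x))" for i
    using Suc.prems by (intro ext) (simp add: partial_mult)
  have "C_k k f" "C_k k g" using Suc.prems C_k_Suc_imp by blast+
  then have "C_k k (partial i (\<lambda>x. f x * g x))" for i
    unfolding eq using Suc by (intro C_k_lincomb Suc.IH) auto
  with Suc.prems show ?case by (auto intro!: derivative_intros)
qed

lemma C_k_grad_inner: "C_k (Suc k) f \<Longrightarrow> C_k k (\<lambda>x. grad f x \<bullet> d)"
  unfolding grad_inner_eq by (rule C_k_lincomb) auto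

lemma grad_mult_inner:
  assumes "f differentiable (at x)" "g differentiable (at x)"
  shows "grad (\<lambda>x. f x * g x) x \<bullet> d = f x * (grad g x \<bullet> d) + (grad f x \<bullet> d) * g x"
  by (simp add: grad_inner_eq partial_mult assms algebra_simps)

section \<open>Polynomials of bounded total degree\<close>

lemma poly_index_finite: "finite {(i::nat, j::nat). i + j \<le> k}"
  by (rule finite_subset[of _ "{..k} \<times> {..k}"]) auto

lemma poly_space_lincomb:
  assumes "p \<in> poly_space k" "q \<in> poly_space k"
  shows "(\<lambda>x. a * p x + b * q x) \<in> poly_space k"
proof -
  obtain c c' where "\<And>x. p x = (\<Sum>(i, j) \<in> {(i, j). i + j \<le> k}. c i j * x$1 ^ i * x$2 ^ j)"
    "\<And>x. q x = (\<Sum>(i, j) \<in> {(i, j). i + j \<le> k}. c' i j * x$1 ^ i * x$2 ^ j)"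
    using assms unfolding poly_space_def by blast
  then have "a * p x + b * q x =
      (\<Sum>(i, j) \<in> {(i, j). i + j \<le> k}. (a * c i j + b * c' i j) * x$1 ^ i * x$2 ^ j)" for x
    by (simp add: sum_distrib_left sum.distrib[symmetric] case_prod_unfold algebra_simps)
  then show ?thesis unfolding poly_space_def
    by (intro CollectI exI[of _ "\<lambda>i j. a * c i j + b * c' i j"]) simp
qed

lemma poly_space_monom:
  assumes "i + j \<le> k"
  shows "(\<lambda>x. x$1 ^ i * x$2 ^ j) \<in> poly_space k"
proof -
  have "x$1 ^ i * x$2 ^ j = (\<Sum>(i', j') \<in> {(i, j). i + j \<le> k}.
      of_bool (i' = i \<and> j' = j) * x$1 ^ i' * x$2 ^ j')" for x :: "real^2"
  proof -
    have "(\<Sum>(i', j') \<in> {(i, j). i + j \<le> k}. of_bool (i' = i \<and> j' = j) * x$1 ^ i' * x$2 ^ j')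
      = (\<Sum>z \<in> {(i, j). i + j \<le> k}. if z = (i, j) then x$1 ^ i * x$2 ^ j else 0)"
      by (intro sum.cong) auto
    also have "\<dots> = x$1 ^ i * x$2 ^ j"
      using assms by (simp add: sum.delta poly_index_finite)
    finally show ?thesis by simp
  qed
  then show ?thesis unfolding poly_space_def
    by (intro CollectI exI[of _ "\<lambda>i' j'. of_bool (i' = i \<and> j' = j)"]) simp
qed

lemma poly_space_zero: "(\<lambda>x. 0) \<in> poly_space k"
  using poly_space_lincomb[OF poly_space_monom[of 0 0 k] poly_space_monom[of 0 0 k], of 0 0] by simp

lemma poly_space_sum:
  assumes "finite I" "\<And>z. z \<in> I \<Longrightarrow> p z \<in> poly_space k"
  shows "(\<lambda>x. \<Sum>z\<in>I. c z * p z x) \<in> poly_space k"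
  using assms
proof (induction I rule: finite_induct)
  case empty
  show ?case by (simp add: poly_space_zero)
next
  case (insert z I)
  have "(\<lambda>x. c z * p z x + 1 * (\<Sum>z\<in>I. c z * p z x)) \<in> poly_space k"
    using insert by (intro poly_space_lincomb) auto
  with insert show ?case by simp
qed

lemma poly_space_mono: "k \<le> l \<Longrightarrow> poly_space k \<subseteq> poly_space l"
proof
  fix p assume kl: "k \<le> l" and "p \<in> poly_space k"
  then obtain c where c: "\<And>x. p x = (\<Sum>(i, j) \<in> {(i, j). i + j \<le> k}. c i j * x$1 ^ i * x$2 ^ j)"
    unfolding poly_space_def by blast
  have "(\<lambda>x. \<Sum>z\<in>{(i, j). i + j \<le> k}. case_prod c z * (x$1 ^ fst z * x$2 ^ snd z)) \<in> poly_space l"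
    using kl by (intro poly_space_sum poly_index_finite poly_space_monom) auto
  moreover have "p = (\<lambda>x. \<Sum>z\<in>{(i, j). i + j \<le> k}. case_prod c z * (x$1 ^ fst z * x$2 ^ snd z))"
    by (auto simp: c case_prod_unfold mult.assoc)
  ultimately show "p \<in> poly_space l" by simp
qed

lemma poly_space_partial:
  assumes "p \<in> poly_space (Suc k)"
  shows "p differentiable (at x)" and "partial m p \<in> poly_space k"
proof -
  obtain c where c: "p = (\<lambda>x. \<Sum>z \<in> {(i, j). i + j \<le> Suc k}. case_prod c z * (x$1 ^ fst z * x$2 ^ snd z))"
    using assms unfolding poly_space_def by (auto simp: case_prod_unfold mult.assoc)
  define D where "D x h = (\<Sum>z \<in> {(i, j). i + j \<le> Suc k}. case_prod c z *
      (x$1 ^ fst z * (of_nat (snd z) * h$2 * x$2 ^ (snd z - 1)) +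
       (of_nat (fst z) * h$1 * x$1 ^ (fst z - 1)) * x$2 ^ snd z))" for x h :: "real^2"
  have D: "(p has_derivative D x) (at x)" for x
  proof -
    have "bounded_linear (\<lambda>x::real^2. x$i)" for i by (rule bounded_linear_vec_nth)
    then have *: "((\<lambda>x::real^2. x$i) has_derivative (\<lambda>h. h$i)) (at x)" for i
      by (rule bounded_linear_imp_has_derivative)
    have pow: "((\<lambda>x::real^2. x$i ^ n) has_derivative (\<lambda>h. of_nat n * h$i * x$i ^ (n - 1))) (at x)" for i n
      using has_derivative_power[OF *[of i]] .
    show ?thesis unfolding c D_def
      by (intro has_derivative_sum has_derivative_mult_right has_derivative_mult pow)
  qed
  show "p differentiable (at x)" using D differentiable_def by blast
  have pm: "partial m p = (\<lambda>x. D x (axis m 1))" using partial_eqI[OF D] by blast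
  \<comment> \<open>A zero exponent is split off because subtraction truncates: the monomial left
    over could have degree \<open>Suc k\<close>. Its coefficient vanishes, but membership in
    \<open>poly_space k\<close> is checked for every monomial.\<close>
  define q where "q z = (if m = 1 then
      (if fst z = 0 then (\<lambda>x::real^2. 0)
        else (\<lambda>x. x$1 ^ (fst z - 1) * x$2 ^ snd z))
    else (if snd z = 0 then (\<lambda>x::real^2. 0)
        else (\<lambda>x. x$1 ^ fst z * x$2 ^ (snd z - 1))))" for z :: "nat \<times> nat"
  have "partial m p = (\<lambda>x. \<Sum>z \<in> {(i, j). i + j \<le> Suc k}.
      (case_prod c z * of_nat (if m = 1 then fst z else snd z)) * q z x)"
    unfolding pm D_def q_def using exhaust_2[of m]
    by (intro ext sum.cong) (auto simp: axis_def)
  also have "\<dots> \<in> poly_space k"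
    unfolding q_def
    by (intro poly_space_sum poly_index_finite)
       (auto intro!: poly_space_zero poly_space_monom
          poly_space_monom[where i = 0, simplified] poly_space_monom[where j = 0, simplified])
  finally show "partial m p \<in> poly_space k" .
qed

lemma poly_space_C_k: "p \<in> poly_space k \<Longrightarrow> C_k n p"
proof (induction n arbitrary: p)
  case 0
  then have "p \<in> poly_space (Suc k)" using poly_space_mono[of k "Suc k"] by auto
  then show ?case
    using poly_space_partial(1) by (auto intro!: continuous_at_imp_continuous_on differentiable_imp_continuous_within)
next
  case (Suc n)
  then have "p \<in> poly_space (Suc k)" using poly_space_mono[of k "Suc k"] by auto
  then show ?case using poly_space_partial[of p k] Suc.IH by simp
qed

lemma poly_space_grad_inner: "p \<in> poly_space (Suc k) \<Longrightarrow> (\<lambda>x. grad p x \<bullet> d) \<in> poly_space k"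
  unfolding grad_inner_eq by (intro poly_space_lincomb poly_space_partial(2))

text \<open>Coordinates are affine along a line, so the total degree bounds the degree in
  \<open>t\<close>. Questions about a piece on an edge become questions about one univariate
  polynomial.\<close>

lemma poly_space_line:
  assumes "p \<in> poly_space k"
  obtains q where "degree q \<le> k" "\<And>t. p (x + t *\<^sub>R d) = poly q t"
proof -
  obtain c where c: "\<And>x. p x = (\<Sum>(i, j) \<in> {(i, j). i + j \<le> k}. c i j * x$1 ^ i * x$2 ^ j)"
    using assms unfolding poly_space_def by blast
  define q where "q = (\<Sum>(i, j) \<in> {(i, j). i + j \<le> k}. smult (c i j) ([:x$1, d$1:] ^ i * [:x$2, d$2:] ^ j))"
  have "degree ([:a, b:] ^ n) \<le> n" for a b :: real and n
    using degree_power_le[of "[:a, b:]" n] by (auto intro: order_trans)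
  then have "degree ([:x$1, d$1:] ^ i * [:x$2, d$2:] ^ j) \<le> i + j" for i j
    by (meson add_mono degree_mult_le order_trans)
  then have "degree q \<le> k" unfolding q_def
    by (intro degree_sum_le poly_index_finite) (auto intro: order_trans[OF degree_smult_le] order_trans)
  moreover have "p (x + t *\<^sub>R d) = poly q t" for t
    unfolding q_def c by (simp add: poly_sum case_prod_unfold mult.assoc)
  ultimately show ?thesis using that by blast
qed

lemma has_real_derivative_line:
  assumes "f differentiable (at (x + t *\<^sub>R d))"
  shows "((\<lambda>s. f (x + s *\<^sub>R d)) has_real_derivative (grad f (x + t *\<^sub>R d) \<bullet> d)) (at t)"
proof -
  have "((\<lambda>s. x + s *\<^sub>R d) has_derivative (\<lambda>h. h *\<^sub>R d)) (at t)"
    by (auto intro!: derivative_eq_intros)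
  from diff_chain_at[OF this, of f, OF has_derivative_grad[OF assms]]
  show ?thesis
    by (simp add: has_field_derivative_def o_def mult.commute mult_commute_abs)
qed

section \<open>Weak derivatives of piecewise smooth functions\<close>

lemma integral_lborel_translation:
  fixes f :: "'a::euclidean_space \<Rightarrow> real"
  assumes "f \<in> borel_measurable lborel"
  shows "(\<integral>x. f (x + c) \<partial>lborel) = (\<integral>x. f x \<partial>lborel)"
proof -
  have "(\<integral>x. f x \<partial>lborel) = (\<integral>x. f x \<partial>distr lborel borel ((+) c))"
    by (simp add: lborel_distr_plus)
  also have "\<dots> = (\<integral>x. f (c + x) \<partial>lborel)"
    using assms by (intro integral_distr) auto
  finally show ?thesis by (simp add: add.commute)
qed

lemma integrable_lborel_translation:
  fixes f :: "'a::euclidean_space \<Rightarrow> real"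
  assumes "integrable lborel f"
  shows "integrable lborel (\<lambda>x. f (x + c))"
proof -
  have "integrable (distr lborel borel ((+) c)) f" using assms by (simp add: lborel_distr_plus)
  then have "integrable lborel (\<lambda>x. f (c + x))"
    using assms by (subst (asm) integrable_distr_eq) auto
  then show ?thesis by (simp add: add.commute)
qed

text \<open>
  The integral of each difference quotient vanishes by translation invariance, and the quotients
  are dominated.
\<close>

lemma integral_directional_deriv_eq_0:
  fixes H D :: "'a::euclidean_space \<Rightarrow> real"
  assumes H: "integrable lborel H" and D: "D \<in> borel_measurable lborel"
    and zero: "\<And>x. x \<notin> cball 0 R \<Longrightarrow> H x = 0"
    and lip: "\<And>s. AE x in lborel. \<bar>H (x + s *\<^sub>R d) - H x\<bar> \<le> L * \<bar>s\<bar>"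
    and lim: "AE x in lborel. ((\<lambda>s. (H (x + s *\<^sub>R d) - H x) / s) \<longlongrightarrow> D x) (at 0)"
  shows "(\<integral>x. D x \<partial>lborel) = 0"
proof -
  define s where "s n = inverse (real (Suc n))" for n
  have s: "s n > 0" "s n \<le> 1" for n by (auto simp: s_def inverse_le_1_iff)
  define q where "q n x = (H (x + s n *\<^sub>R d) - H x) / s n" for n x
  \<comment> \<open>Since \<open>s n \<le> 1\<close>, all quotients vanish outside the ball enlarged
    by \<open>norm d\<close>; inside it they are bounded by \<open>L\<close> almost
    everywhere.\<close>
  define w where "w x = L * indicator (cball 0 (R + norm d)) x" for x :: 'a
  have Hm[measurable]: "H \<in> borel_measurable borel" using H by simp
  have "(\<lambda>n. \<integral>x. q n x \<partial>lborel) \<longlonglongrightarrow> (\<integral>x. D x \<partial>lborel)"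
  proof (rule integral_dominated_convergence[where w = w])
    show "D \<in> borel_measurable lborel" by fact
    show "q n \<in> borel_measurable lborel" for n unfolding q_def by measurable
    show "integrable lborel w"
      unfolding w_def by (intro integrable_mult_right integrable_real_indicator)
        (simp_all add: emeasure_lborel_cball_finite[unfolded infinity_ennreal_def])
    have "s \<longlonglongrightarrow> 0" unfolding s_def by (rule LIMSEQ_inverse_real_of_nat)
    then have flt: "filterlim s (at 0) sequentially"
      using s(1) by (auto simp: filterlim_at less_le)
    show "AE x in lborel. (\<lambda>n. q n x) \<longlonglongrightarrow> D x"
      unfolding q_def using lim by (rule eventually_mono) (rule filterlim_compose[OF _ flt])
    \<comment> \<open>The exceptional null set of \<open>lip\<close> may depend on the increment;
      domination uses it for one \<open>n\<close> at a time.\<close>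
    show "AE x in lborel. norm (q n x) \<le> w x" for n
      using lip[of "s n"]
    proof eventually_elim
      fix x assume l: "\<bar>H (x + s n *\<^sub>R d) - H x\<bar> \<le> L * \<bar>s n\<bar>"
      have "norm (x + s n *\<^sub>R d) \<ge> norm x - norm d"
      proof -
        have "norm (s n *\<^sub>R d) \<le> norm d" using s[of n] by (simp add: mult_left_le_one_le)
        moreover have "norm x \<le> norm (x + s n *\<^sub>R d) + norm (s n *\<^sub>R d)"
          using norm_triangle_ineq4[of "x + s n *\<^sub>R d" "s n *\<^sub>R d"] by simp
        ultimately show ?thesis by simp
      qed
      then have "q n x = 0" if "x \<notin> cball 0 (R + norm d)"
      proof -
        have "norm x > R + norm d" using that by simp
        then have "x \<notin> cball 0 R" "x + s n *\<^sub>R d \<notin> cball 0 R"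
          using \<open>norm (x + s n *\<^sub>R d) \<ge> norm x - norm d\<close> norm_ge_zero[of d]
          unfolding mem_cball_0 by linarith+
        then show ?thesis using zero by (simp add: q_def)
      qed
      moreover have "\<bar>q n x\<bar> \<le> L" using l s[of n] by (simp add: q_def abs_divide field_simps)
      ultimately show "norm (q n x) \<le> w x" by (auto simp: w_def indicator_def)
    qed
  qed
  moreover have "(\<integral>x. q n x \<partial>lborel) = 0" for n
    using H integrable_lborel_translation[OF H] by (simp add: q_def integral_lborel_translation)
  ultimately show ?thesis by (simp add: LIMSEQ_const_iff)
qed

text \<open>Compactness bounds the gradient, and convexity turns this bound into a Lipschitz
  constant by the mean value inequality.\<close>

lemma C_1_lipschitz_on:
  assumes f: "C_k (Suc 0) f" and "compact T" "convex T"
  obtains L where "L \<ge> 0" "L-lipschitz_on T f"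
proof -
  have "continuous_on T (\<lambda>x. partial i f x)" for i
    using f by (auto intro: continuous_on_subset)
  then have "continuous_on T (\<lambda>x. norm (grad f x))"
    unfolding grad_def by (intro continuous_intros continuous_on_vec_lambda)
  then have "bounded ((\<lambda>x. norm (grad f x)) ` T)"
    using \<open>compact T\<close> compact_continuous_image compact_imp_bounded by blast
  then obtain L where L: "L > 0" "\<And>x. x \<in> T \<Longrightarrow> norm (grad f x) \<le> L"
    by (auto simp: bounded_pos)
  have "L-lipschitz_on T f"
  proof (rule bounded_derivative_imp_lipschitz[OF _ \<open>convex T\<close>])
    show "(f has_derivative (\<lambda>h. grad f x \<bullet> h)) (at x within T)" for x
      by (rule has_derivative_at_withinI, rule has_derivative_grad) (use f in simp)
    show "onorm (\<lambda>h. grad f x \<bullet> h) \<le> L" if "x \<in> T" for x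
    proof (rule onorm_bound)
      fix h
      have "\<bar>grad f x \<bullet> h\<bar> \<le> norm (grad f x) * norm h" by (rule Cauchy_Schwarz_ineq2)
      also have "\<dots> \<le> L * norm h" using L that by (intro mult_right_mono) auto
      finally show "norm (grad f x \<bullet> h) \<le> L * norm h" by simp
    qed (use L in auto)
  qed (use L in auto)
  with L show ?thesis by (intro that) auto
qed

section \<open>Piecewise functions on convex cells\<close>

definition pw :: "(real^2) set set \<Rightarrow> ((real^2) set \<Rightarrow> real^2 \<Rightarrow> real) \<Rightarrow> real^2 \<Rightarrow> real" where
  "pw \<T> f x = (\<Sum>T\<in>\<T>. indicator (interior T) x * f T x)"

lemma AE_negligible_lborel: "negligible N \<Longrightarrow> AE x in lborel. (x::'a::euclidean_space) \<notin> N"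
  by (subst AE_completion_iff[symmetric]) (simp add: negligible_iff_null_sets AE_not_in)

text \<open>The measure-theoretic side of a triangulation: \<open>disj\<close> confines overlaps of
  distinct cells to their frontiers. How the pieces fit together enters later through the hypotheses
  named \<open>agree\<close>.\<close>

locale convex_cells =
  fixes \<T> :: "(real^2) set set" and \<Omega> :: "(real^2) set"
  assumes fin: "finite \<T>"
    and comp: "\<And>T. T \<in> \<T> \<Longrightarrow> compact T"
    and conv: "\<And>T. T \<in> \<T> \<Longrightarrow> convex T"
    and disj: "\<And>T T'. T \<in> \<T> \<Longrightarrow> T' \<in> \<T> \<Longrightarrow> T \<noteq> T' \<Longrightarrow> interior T \<inter> T' = {}"
    and opn: "open \<Omega>"
    and cover: "\<Omega> \<subseteq> \<Union>\<T>"
begin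

lemma pw_interior:
  assumes "T \<in> \<T>" "x \<in> interior T"
  shows "pw \<T> f x = f T x"
proof -
  have "indicator (interior T') x * f T' x = (if T' = T then f T x else 0)" if "T' \<in> \<T>" for T'
    using that assms disj[OF assms(1) that] interior_subset[of T'] by (auto simp: indicator_def)
  then have "pw \<T> f x = (\<Sum>T'\<in>\<T>. if T' = T then f T x else 0)"
    unfolding pw_def by (intro sum.cong) auto
  with assms fin show ?thesis by (simp add: sum.delta)
qed

lemma pw_outside: "x \<notin> \<Union>\<T> \<Longrightarrow> pw \<T> f x = 0"
  unfolding pw_def using interior_subset by (intro sum.neutral) (auto simp: indicator_def)

lemma pw_integrable:
  assumes "\<And>T. T \<in> \<T> \<Longrightarrow> continuous_on UNIV (f T)"
  shows "integrable lborel (pw \<T> f)"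
proof -
  have "integrable lborel (\<lambda>x. indicator (interior T) x * f T x)" if "T \<in> \<T>" for T
  proof -
    have "set_integrable lborel T (f T)"
      unfolding set_integrable_def using assms[OF that]
      by (intro borel_integrable_compact comp that) (rule continuous_on_subset, auto)
    then have "set_integrable lborel (interior T) (f T)"
      by (rule set_integrable_subset) (auto simp: interior_subset)
    then show ?thesis by (simp add: set_integrable_def)
  qed
  then show ?thesis unfolding pw_def[abs_def] using fin by (intro Bochner_Integration.integrable_sum) auto
qed

lemma pw_mult_integrable:
  assumes "\<And>T. T \<in> \<T> \<Longrightarrow> continuous_on UNIV (f T)" "continuous_on UNIV g"
  shows "integrable lborel (\<lambda>x. pw \<T> f x * g x)"
proof -
  have "integrable lborel (pw \<T> (\<lambda>T x. f T x * g x))"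
    using assms by (intro pw_integrable continuous_on_mult)
  moreover have "(\<lambda>x. pw \<T> f x * g x) = pw \<T> (\<lambda>T x. f T x * g x)"
    by (simp add: fun_eq_iff pw_def sum_distrib_right mult.assoc)
  ultimately show ?thesis by simp
qed

lemma negligible_skeleton: "negligible (\<Union>T\<in>\<T>. frontier T)"
  using fin conv by (auto intro!: negligible_Union negligible_convex_frontier)

text \<open>The shift is there because both ends of a difference quotient, \<open>x\<close> and
  \<open>x + s *\<^sub>R d\<close>, have to avoid the skeleton.\<close>

lemma AE_not_skeleton: "AE x in lborel. x + c \<notin> (\<Union>T\<in>\<T>. frontier T)"
proof -
  have "negligible ((+) (- c) ` (\<Union>T\<in>\<T>. frontier T))"
    by (rule negligible_translation[OF negligible_skeleton])
  from AE_negligible_lborel[OF this] show ?thesis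
    by eventually_elim (force simp: image_iff)
qed

text \<open>
  Both \<open>pw\<close> and \<open>glue\<close> are assembled from the pieces \<open>f T\<close> and agree almost everywhere. While \<open>pw\<close>
  vanishes on the skeleton and is obviously measurable, \<open>glue\<close> is continuous along every line on
  which the pieces match.
\<close>

definition glue :: "((real^2) set \<Rightarrow> real^2 \<Rightarrow> real) \<Rightarrow> real^2 \<Rightarrow> real" where
  "glue f x = (if x \<in> \<Union>\<T> then f (SOME T. T \<in> \<T> \<and> x \<in> T) x else 0)"

text \<open>Off the skeleton a point of a cell lies in its interior, where no other cell reaches, so
  the choice made by \<open>glue\<close> is forced.\<close>

lemma glue_eq_pw:
  assumes "x \<notin> (\<Union>T\<in>\<T>. frontier T)"
  shows "pw \<T> f x = glue f x"
proof (cases "x \<in> \<Union>\<T>")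
  case True
  define T where "T = (SOME T. T \<in> \<T> \<and> x \<in> T)"
  have T: "T \<in> \<T>" "x \<in> T" using True someI_ex[of "\<lambda>T. T \<in> \<T> \<and> x \<in> T"] by (auto simp: T_def)
  then have "x \<in> interior T" using assms by (auto simp: frontier_def closure_def)
  with T True show ?thesis by (simp add: pw_interior glue_def T_def)
qed (simp add: glue_def pw_outside)

text \<open>Pulled back to the line, the cells and the complement of \<Omega> are finitely many
  closed sets that cover it. On each of them \<open>g\<close> is Lipschitz with the same constant,
  and this passes to intervals.\<close>

lemma glue_line_lipschitz:
  assumes lip: "\<And>T. T \<in> \<T> \<Longrightarrow> L-lipschitz_on T (f T)" and "L \<ge> 0"
    and zero: "\<And>T x. T \<in> \<T> \<Longrightarrow> x \<notin> \<Omega> \<Longrightarrow> f T x = 0"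
    and agree: "\<And>T T' t. T \<in> \<T> \<Longrightarrow> T' \<in> \<T> \<Longrightarrow> x + t *\<^sub>R d \<in> T \<Longrightarrow> x + t *\<^sub>R d \<in> T' \<Longrightarrow>
      f T (x + t *\<^sub>R d) = f T' (x + t *\<^sub>R d)"
  shows "\<bar>glue f (x + s *\<^sub>R d) - glue f x\<bar> \<le> L * norm d * \<bar>s\<bar>"
proof -
  define g where "g t = glue f (x + t *\<^sub>R d)" for t
  define U where "U S = (\<lambda>t. x + t *\<^sub>R d) -` S" for S
  have U: "closed (U S)" if "closed S" for S
    unfolding U_def using that by (intro closed_vimage) (auto intro!: continuous_intros)
  \<comment> \<open>By \<open>agree\<close> the value does not depend on which cell
    \<open>SOME\<close> picks.\<close>
  have gT: "g t = f T (x + t *\<^sub>R d)" if "T \<in> \<T>" "t \<in> U T" for T t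
  proof -
    define T' where "T' = (SOME T. T \<in> \<T> \<and> x + t *\<^sub>R d \<in> T)"
    have "T' \<in> \<T>" "x + t *\<^sub>R d \<in> T'"
      using that someI_ex[of "\<lambda>T. T \<in> \<T> \<and> x + t *\<^sub>R d \<in> T"] by (auto simp: T'_def U_def)
    then have "f T' (x + t *\<^sub>R d) = f T (x + t *\<^sub>R d)"
      using that by (intro agree) (auto simp: U_def)
    then show ?thesis using that unfolding g_def glue_def U_def T'_def by auto
  qed
  have g0: "g t = 0" if "t \<in> U (- \<Omega>)" for t
  proof (cases "x + t *\<^sub>R d \<in> \<Union>\<T>")
    case True
    then obtain T where T: "T \<in> \<T>" "x + t *\<^sub>R d \<in> T" by blast
    with gT[of T t] zero[of T "x + t *\<^sub>R d"] that show ?thesis by (simp add: U_def)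
  qed (simp add: g_def glue_def)
  have L': "L * norm d \<ge> 0" using \<open>L \<ge> 0\<close> by simp
  have T: "(L * norm d)-lipschitz_on (U T) g" if "T \<in> \<T>" for T
  proof (rule lipschitz_onI[OF _ L'])
    fix t u assume tu: "t \<in> U T" "u \<in> U T"
    then have "dist (f T (x + t *\<^sub>R d)) (f T (x + u *\<^sub>R d)) \<le> L * dist (x + t *\<^sub>R d) (x + u *\<^sub>R d)"
      by (intro lipschitz_onD[OF lip[OF that]]) (auto simp: U_def)
    also have "dist (x + t *\<^sub>R d) (x + u *\<^sub>R d) = norm d * dist t u"
      by (simp add: dist_norm scaleR_diff_left[symmetric])
    finally show "dist (g t) (g u) \<le> L * norm d * dist t u"
      using tu gT[OF that] by (simp add: mult.assoc)
  qed
  have "(L * norm d)-lipschitz_on {a..b} g" for a b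
  proof (rule lipschitz_on_closed_Union[of "insert (- \<Omega>) \<T>" _ U])
    show "(L * norm d)-lipschitz_on (U S) g" if "S \<in> insert (- \<Omega>) \<T>" for S
      using that T g0 L' by (auto simp: lipschitz_on_def)
    show "closed (U S)" if "S \<in> insert (- \<Omega>) \<T>" for S
      using that U comp opn by (auto simp: compact_imp_closed)
    show "{a..b} \<subseteq> (\<Union>S\<in>insert (- \<Omega>) \<T>. U S)" using cover by (auto simp: U_def)
  qed (use fin L' in auto)
  from lipschitz_onD[OF this[of "min 0 s" "max 0 s"], of s 0]
  show ?thesis by (simp add: g_def dist_norm)
qed

text \<open>A point off the skeleton lies in the interior of a cell or in the open complement of all
  cells; near it \<open>pw\<close> is a single smooth piece or zero.\<close>

lemma pw_directional_deriv:
  assumes f: "\<And>T. T \<in> \<T> \<Longrightarrow> C_k (Suc 0) (f T)" and x: "x \<notin> (\<Union>T\<in>\<T>. frontier T)"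
  shows "((\<lambda>s. (pw \<T> f (x + s *\<^sub>R d) - pw \<T> f x) / s) \<longlongrightarrow> pw \<T> (\<lambda>T x. grad (f T) x \<bullet> d) x) (at 0)"
proof -
  have ev: "\<forall>\<^sub>F s in at 0. x + s *\<^sub>R d \<in> S" if "open S" "x \<in> S" for S
  proof -
    have "((\<lambda>s. x + s *\<^sub>R d) \<longlongrightarrow> x + 0 *\<^sub>R d) (at (0::real))" by (intro tendsto_intros)
    with that show ?thesis by (simp add: tendsto_def)
  qed
  show ?thesis
  proof (cases "x \<in> \<Union>\<T>")
    case True
    then obtain T where T: "T \<in> \<T>" "x \<in> T" by blast
    then have xi: "x \<in> interior T" using x by (auto simp: frontier_def closure_def)
    have "((\<lambda>s. f T (x + s *\<^sub>R d)) has_real_derivative (grad (f T) (x + 0 *\<^sub>R d) \<bullet> d)) (at 0)"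
      using f[OF T(1)] by (intro has_real_derivative_line) simp
    then have "((\<lambda>s. (f T (x + s *\<^sub>R d) - f T x) / s) \<longlongrightarrow> grad (f T) x \<bullet> d) (at 0)"
      by (simp add: has_field_derivative_iff)
    moreover have q: "\<forall>\<^sub>F s in at 0. (pw \<T> f (x + s *\<^sub>R d) - pw \<T> f x) / s = (f T (x + s *\<^sub>R d) - f T x) / s"
      using ev[OF open_interior xi] by eventually_elim (simp add: pw_interior[OF T(1)] xi)
    ultimately show ?thesis
      unfolding pw_interior[OF T(1) xi, of "\<lambda>T x. grad (f T) x \<bullet> d"] tendsto_cong[OF q] by blast
  next
    case False
    have "open (- \<Union>\<T>)" by (intro open_Compl closed_Union fin ballI compact_imp_closed comp)
    from ev[OF this] False
    have "\<forall>\<^sub>F s in at 0. (pw \<T> f (x + s *\<^sub>R d) - pw \<T> f x) / s = 0"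
      by (auto elim!: eventually_mono simp: pw_outside)
    then show ?thesis using False by (simp add: pw_outside tendsto_eventually)
  qed
qed

text \<open>The points excluded by the finite set \<open>A\<close> fill finitely many lines
  orthogonal to \<open>l\<close>, a null set preserved by shifts along \<open>d\<close>. On the
  other lines in direction \<open>d\<close> the pieces match and \<open>glue f\<close> is Lipschitz;
  almost everywhere the bound carries over to \<open>pw\<close>.\<close>

lemma integral_pw_deriv_eq_0:
  assumes f: "\<And>T. T \<in> \<T> \<Longrightarrow> C_k (Suc 0) (f T)"
    and zero: "\<And>T x. T \<in> \<T> \<Longrightarrow> x \<notin> \<Omega> \<Longrightarrow> f T x = 0"
    and l: "l \<noteq> 0" "l \<bullet> d = 0" and A: "finite A"
    and agree: "\<And>T T' x. T \<in> \<T> \<Longrightarrow> T' \<in> \<T> \<Longrightarrow> x \<in> T \<Longrightarrow> x \<in> T' \<Longrightarrow> l \<bullet> x \<notin> A \<Longrightarrow> f T x = f T' x"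
  shows "(\<integral>x. pw \<T> (\<lambda>T x. grad (f T) x \<bullet> d) x \<partial>lborel) = 0"
proof -
  have "\<forall>T\<in>\<T>. \<exists>L. L \<ge> 0 \<and> L-lipschitz_on T (f T)"
    by (metis C_1_lipschitz_on[OF f comp conv])
  then obtain M where M: "\<And>T. T \<in> \<T> \<Longrightarrow> M T \<ge> 0 \<and> (M T)-lipschitz_on T (f T)" by metis
  \<comment> \<open>The sum is one Lipschitz constant for all of the finitely many pieces.\<close>
  define L where "L = (\<Sum>T\<in>\<T>. M T)"
  have L: "L \<ge> 0" "L-lipschitz_on T (f T)" if "T \<in> \<T>" for T
  proof -
    have "M T \<le> L" unfolding L_def using M fin that by (intro member_le_sum) auto
    then show "L-lipschitz_on T (f T)" using M[OF that] lipschitz_on_le by blast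
  qed (auto simp: L_def M sum_nonneg)
  have L0: "L \<ge> 0" by (auto simp: L_def M sum_nonneg)
  have "bounded (\<Union>\<T>)" 
    using fin comp by (intro bounded_Union ballI compact_imp_bounded)
  then obtain R where R: "\<Union>\<T> \<subseteq> cball 0 R" using bounded_subset_ballD[of "\<Union>\<T>" 0] ball_subset_cball by blast
  have "negligible {x. l \<bullet> x \<in> A}"
  proof -
    have "{x. l \<bullet> x \<in> A} = (\<Union>a\<in>A. {x. l \<bullet> x = a})" by auto
    then show ?thesis using A l by (auto intro!: negligible_Union negligible_hyperplane)
  qed
  note good = AE_negligible_lborel[OF this]
  show ?thesis
  proof (rule integral_directional_deriv_eq_0[where H = "pw \<T> f" and d = d and L = "L * norm d" and R = R])
    show "integrable lborel (pw \<T> f)"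
      using f C_k_continuous by (intro pw_integrable) blast
    have "integrable lborel (pw \<T> (\<lambda>T x. grad (f T) x \<bullet> d))"
      using C_k_continuous[OF C_k_grad_inner[OF f]] by (intro pw_integrable) blast
    then show "pw \<T> (\<lambda>T x. grad (f T) x \<bullet> d) \<in> borel_measurable lborel" by simp
    show "pw \<T> f x = 0" if "x \<notin> cball 0 R" for x using that R by (intro pw_outside) auto
    show "AE x in lborel. ((\<lambda>s. (pw \<T> f (x + s *\<^sub>R d) - pw \<T> f x) / s) \<longlongrightarrow>
        pw \<T> (\<lambda>T x. grad (f T) x \<bullet> d) x) (at 0)"
      using AE_not_skeleton[of 0] by eventually_elim (rule pw_directional_deriv[OF f], auto)
    show "AE x in lborel. \<bar>pw \<T> f (x + s *\<^sub>R d) - pw \<T> f x\<bar> \<le> L * norm d * \<bar>s\<bar>" for s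
      using good AE_not_skeleton[of 0] AE_not_skeleton[of "s *\<^sub>R d"]
    proof eventually_elim
      fix x assume x: "x \<notin> {x. l \<bullet> x \<in> A}" "x + 0 \<notin> (\<Union>T\<in>\<T>. frontier T)"
        "x + s *\<^sub>R d \<notin> (\<Union>T\<in>\<T>. frontier T)"
      have "l \<bullet> (x + t *\<^sub>R d) \<notin> A" for t using x l by (simp add: inner_add_right)
      then have "\<bar>glue f (x + s *\<^sub>R d) - glue f x\<bar> \<le> L * norm d * \<bar>s\<bar>"
        by (intro glue_line_lipschitz[OF L(2) L0 zero] agree)
      with x show "\<bar>pw \<T> f (x + s *\<^sub>R d) - pw \<T> f x\<bar> \<le> L * norm d * \<bar>s\<bar>"
        by (simp add: glue_eq_pw)
    qed
  qed
qed

text \<open>The vanishing integral of a derivative is applied to the products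
  \<open>w T x * \<psi> x\<close>: they are zero off \<Omega> because of \<psi> and inherit the
  matching of the \<open>w T\<close>, so the product rule leaves no jump terms.\<close>

lemma pw_integration_by_parts:
  assumes w: "\<And>T. T \<in> \<T> \<Longrightarrow> C_k (Suc 0) (w T)" and \<psi>: "C_k (Suc 0) \<psi>"
    and zero: "\<And>x. x \<notin> \<Omega> \<Longrightarrow> \<psi> x = 0"
    and l: "l \<noteq> 0" "l \<bullet> d = 0" and A: "finite A"
    and agree: "\<And>T T' x. T \<in> \<T> \<Longrightarrow> T' \<in> \<T> \<Longrightarrow> x \<in> T \<Longrightarrow> x \<in> T' \<Longrightarrow> l \<bullet> x \<notin> A \<Longrightarrow> w T x = w T' x"
  shows "(\<integral>x. pw \<T> w x * (grad \<psi> x \<bullet> d) \<partial>lborel) = - (\<integral>x. pw \<T> (\<lambda>T x. grad (w T) x \<bullet> d) x * \<psi> x \<partial>lborel)"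
proof -
  have c: "continuous_on UNIV (w T)" "continuous_on UNIV (\<lambda>x. grad (w T) x \<bullet> d)" if "T \<in> \<T>" for T
    using C_k_continuous C_k_grad_inner w[OF that] by blast+
  have c': "continuous_on UNIV \<psi>" "continuous_on UNIV (\<lambda>x. grad \<psi> x \<bullet> d)"
    using C_k_continuous C_k_grad_inner \<psi> by blast+
  have "(\<integral>x. pw \<T> (\<lambda>T x. grad (\<lambda>x. w T x * \<psi> x) x \<bullet> d) x \<partial>lborel) = 0"
  proof (rule integral_pw_deriv_eq_0[OF _ _ l A])
    show "C_k (Suc 0) (\<lambda>x. w T x * \<psi> x)" if "T \<in> \<T>" for T
      by (rule C_k_mult[OF w[OF that] \<psi>])
    show "w T x * \<psi> x = w T' x * \<psi> x"
      if "T \<in> \<T>" "T' \<in> \<T>" "x \<in> T" "x \<in> T'" "l \<bullet> x \<notin> A" for T T' x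
      by (simp only: agree[OF that])
  qed (simp add: zero)
  moreover have "pw \<T> (\<lambda>T x. grad (\<lambda>x. w T x * \<psi> x) x \<bullet> d) x =
      pw \<T> w x * (grad \<psi> x \<bullet> d) + pw \<T> (\<lambda>T x. grad (w T) x \<bullet> d) x * \<psi> x" for x
    unfolding pw_def sum_distrib_right sum.distrib[symmetric] using w \<psi>
    by (intro sum.cong) (auto simp: grad_mult_inner algebra_simps)
  moreover have "integrable lborel (\<lambda>x. pw \<T> w x * (grad \<psi> x \<bullet> d))"
    using c c' by (intro pw_mult_integrable)
  moreover have "integrable lborel (\<lambda>x. pw \<T> (\<lambda>T x. grad (w T) x \<bullet> d) x * \<psi> x)"
    using c c' by (intro pw_mult_integrable)
  ultimately show ?thesis
    by (simp only: Bochner_Integration.integral_add eq_neg_iff_add_eq_0)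
qed

end

section \<open>Interpolation on an edge\<close>

lemma poly_degree_le_3:
  assumes "degree (q :: real poly) \<le> 3"
  obtains a b c d where "q = [:a, b, c, d:]"
proof
  show "q = [:coeff q 0, coeff q 1, coeff q 2, coeff q 3:]"
    using assms by (intro poly_eqI) (auto simp: coeff_pCons coeff_eq_0 numeral_eq_Suc split: nat.splits)
qed

text \<open>Values and tangential derivatives share the same four coefficients, so prescribing them
  at points of an edge gives linear equations for these.\<close>

lemma cubic_line:
  assumes "p \<in> poly_space 3"
  obtains c0 c1 c2 c3 where
    "\<And>t. p (x + t *\<^sub>R d) = c0 + c1 * t + c2 * t^2 + c3 * t^3"
    "\<And>t. grad p (x + t *\<^sub>R d) \<bullet> d = c1 + 2 * c2 * t + 3 * c3 * t^2"
proof -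
  obtain q where q: "degree q \<le> 3" "\<And>t. p (x + t *\<^sub>R d) = poly q t"
    using poly_space_line[OF assms] by blast
  obtain c0 c1 c2 c3 where c: "q = [:c0, c1, c2, c3:]" using poly_degree_le_3[OF q(1)] .
  have p: "p (x + t *\<^sub>R d) = c0 + c1 * t + c2 * t^2 + c3 * t^3" for t
    by (simp add: q(2) c algebra_simps power2_eq_square power3_eq_cube)
  have "grad p (x + t *\<^sub>R d) \<bullet> d = c1 + 2 * c2 * t + 3 * c3 * t^2" for t
  proof (rule DERIV_unique)
    show "((\<lambda>s. p (x + s *\<^sub>R d)) has_real_derivative grad p (x + t *\<^sub>R d) \<bullet> d) (at t)"
      using poly_space_partial(1)[of p 2] assms
      by (intro has_real_derivative_line) (simp add: numeral_eq_Suc)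
    show "((\<lambda>s. p (x + s *\<^sub>R d)) has_real_derivative c1 + 2 * c2 * t + 3 * c3 * t^2) (at t)"
      unfolding p by (auto intro!: derivative_eq_intros simp: algebra_simps)
  qed
  with p that show ?thesis by blast
qed

lemma midpoint_as_line: "a + (1 / 2) *\<^sub>R (b - a) = midpoint a b" for a :: "'a::real_vector"
proof -
  have "a = (1 / 2) *\<^sub>R a + (1 / 2) *\<^sub>R a" by (simp add: scaleR_left_distrib[symmetric])
  then show ?thesis by (simp add: midpoint_def algebra_simps)
qed

text \<open>On a type I edge the degrees of freedom are the values at both ends and at the midpoint, and
  one tangential derivative.\<close>

lemma cubic_zero_on_midpoint_edge:
  assumes p: "p \<in> poly_space 3" and "p a = 0" "p b = 0" "p (midpoint a b) = 0" "grad p a \<bullet> (b - a) = 0"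
  shows "p (a + t *\<^sub>R (b - a)) = 0" and "grad p (a + t *\<^sub>R (b - a)) \<bullet> (b - a) = 0"
proof -
  obtain c0 c1 c2 c3 where c:
    "\<And>t. p (a + t *\<^sub>R (b - a)) = c0 + c1 * t + c2 * t^2 + c3 * t^3"
    "\<And>t. grad p (a + t *\<^sub>R (b - a)) \<bullet> (b - a) = c1 + 2 * c2 * t + 3 * c3 * t^2"
    using cubic_line[OF p, of a "b - a"] by blast
  \<comment> \<open>Value and slope at \<open>t = 0\<close> give \<open>c0 = c1 = 0\<close>; the
    other end and the midpoint then give \<open>c2 + c3 = 0\<close> and
    \<open>2 * c2 + c3 = 0\<close>.\<close>
  have "c0 = 0" "c1 = 0" "c2 = 0" "c3 = 0"
    using c(1)[of 0] c(1)[of 1] c(1)[of "1/2"] c(2)[of 0] assms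
    by (simp_all add: midpoint_as_line power2_eq_square power3_eq_cube)
  with c show "p (a + t *\<^sub>R (b - a)) = 0" "grad p (a + t *\<^sub>R (b - a)) \<bullet> (b - a) = 0"
    by simp_all
qed

text \<open>Meant for the type II edge, which has no midpoint value among its degrees of freedom but
  a tangential derivative at both ends.\<close>

lemma cubic_zero_on_Hermite_edge:
  assumes p: "p \<in> poly_space 3" and "p a = 0" "p b = 0" "grad p a \<bullet> (b - a) = 0" "grad p b \<bullet> (b - a) = 0"
  shows "p (a + t *\<^sub>R (b - a)) = 0" and "grad p (a + t *\<^sub>R (b - a)) \<bullet> (b - a) = 0"
proof -
  obtain c0 c1 c2 c3 where c:
    "\<And>t. p (a + t *\<^sub>R (b - a)) = c0 + c1 * t + c2 * t^2 + c3 * t^3"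
    "\<And>t. grad p (a + t *\<^sub>R (b - a)) \<bullet> (b - a) = c1 + 2 * c2 * t + 3 * c3 * t^2"
    using cubic_line[OF p, of a "b - a"] by blast
  have "c0 = 0" "c1 = 0" "c2 = 0" "c3 = 0"
    using c(1)[of 0] c(1)[of 1] c(2)[of 1] c(2)[of 0] assms by simp_all
  with c show "p (a + t *\<^sub>R (b - a)) = 0" "grad p (a + t *\<^sub>R (b - a)) \<bullet> (b - a) = 0"
    by simp_all
qed

text \<open>Meant for the derivative of a cubic along \<open>bar n\<close> on the type II edge: a
  quadratic with three zeros.\<close>

lemma quadratic_zero_on_edge:
  assumes p: "p \<in> poly_space 2" and "p a = 0" "p b = 0" "p (midpoint a b) = 0"
  shows "p (a + t *\<^sub>R (b - a)) = 0"
proof -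
  obtain q where q: "degree q \<le> 2" "\<And>t. p (a + t *\<^sub>R (b - a)) = poly q t"
    using poly_space_line[OF p] by blast
  then have "degree q \<le> 3" by simp
  then obtain c0 c1 c2 c3 where c: "q = [:c0, c1, c2, c3:]" by (rule poly_degree_le_3)
  have "c3 = 0" using q(1) coeff_eq_0[of q 3] by (simp add: c numeral_eq_Suc)
  have "c0 = 0" "c1 = 0" "c2 = 0"
    using q(2)[of 0] q(2)[of 1] q(2)[of "1/2"] assms \<open>c3 = 0\<close>
    by (simp_all add: midpoint_as_line c)
  with \<open>c3 = 0\<close> q c show ?thesis by simp
qed

section \<open>Differences of pieces, plane linear algebra and the type I condition\<close>

lemma grad_diff_inner:
  assumes "p \<in> poly_space k" "q \<in> poly_space k"
  shows "grad (\<lambda>x. p x - q x) x \<bullet> d = grad p x \<bullet> d - grad q x \<bullet> d"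
proof -
  have "p differentiable (at x)" "q differentiable (at x)"
    using assms poly_space_C_k[of _ k "Suc 0"] by auto
  from partial_lincomb[OF this, where a = 1 and b = "-1"]
  have "partial i (\<lambda>x. p x - q x) x = partial i p x - partial i q x" for i by simp
  then show ?thesis by (simp add: grad_inner_eq right_diff_distrib)
qed

lemma poly_space_diff: "p \<in> poly_space k \<Longrightarrow> q \<in> poly_space k \<Longrightarrow> (\<lambda>x. p x - q x) \<in> poly_space k"
  using poly_space_lincomb[of p k q 1 "-1"] by simp

text \<open>Cramer's rule: each coordinate of \<open>g\<close>, multiplied by the determinant, is a
  combination of the two inner products.\<close>

lemma real2_indep_zero:
  fixes g u w :: "real^2"
  assumes "g \<bullet> u = 0" "g \<bullet> w = 0" and det: "u$1 * w$2 - u$2 * w$1 \<noteq> 0"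
  shows "g = 0"
proof -
  have 1: "g$1 * u$1 + g$2 * u$2 = 0" "g$1 * w$1 + g$2 * w$2 = 0"
    using assms by (simp_all add: inner_vec_def sum_2)
  have "g$1 * (u$1 * w$2 - u$2 * w$1) = 0" "g$2 * (u$1 * w$2 - u$2 * w$1) = 0"
    using 1 by algebra+
  with det show ?thesis by (simp add: vec_eq_iff forall_2)
qed

text \<open>A vanishing determinant would make \<open>c - a\<close> a multiple of
  \<open>b - a\<close>. The lemma supplies the condition \<open>det\<close> of
  \<open>real2_indep_zero\<close> at a vertex of a triangle.\<close>

lemma not_collinear_det:
  fixes a :: "real^2"
  assumes "\<not> affine_dependent {a, b, c}" "distinct [a, b, c]"
  shows "(b - a)$1 * (c - a)$2 - (b - a)$2 * (c - a)$1 \<noteq> 0"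
proof
  assume *: "(b - a)$1 * (c - a)$2 - (b - a)$2 * (c - a)$1 = 0"
  define u v where "u = b - a" and "v = c - a"
  have u: "u \<noteq> 0" using assms by (auto simp: u_def)
  have uv: "u$1 * v$2 = u$2 * v$1" using * by (simp add: u_def v_def)
  have "\<exists>k. v = k *\<^sub>R u"
  proof (cases "u$1 = 0")
    case True
    then have "u$2 \<noteq> 0" using u by (simp add: vec_eq_iff forall_2)
    then show ?thesis using True uv
      by (intro exI[of _ "v$2 / u$2"]) (auto simp: vec_eq_iff forall_2)
  next
    case False
    then show ?thesis using uv
      by (intro exI[of _ "v$1 / u$1"]) (auto simp: vec_eq_iff forall_2 field_simps)
  qed
  then obtain k where k: "c - a = k *\<^sub>R (b - a)" by (auto simp: u_def v_def)
  then have "collinear {0, b - a, c - a}" unfolding collinear_lemma by blast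
  then have "collinear {b, a, c}" by (subst collinear_3) (simp_all add: NO_MATCH_def)
  then show False using assms by (auto simp: collinear_3_eq_affine_dependent insert_commute)
qed

lemma closed_segment_diff:
  assumes "x \<in> closed_segment a b" "y \<in> closed_segment a b"
  obtains k where "y - x = k *\<^sub>R (b - a)"
proof -
  obtain u v where "x = (1 - u) *\<^sub>R a + u *\<^sub>R b" "y = (1 - v) *\<^sub>R a + v *\<^sub>R b"
    using assms unfolding in_segment by blast
  then have "y - x = (v - u) *\<^sub>R (b - a)" by (simp only:) (simp add: algebra_simps)
  then show ?thesis by (rule that)
qed

text \<open>The witness is \<open>b - a\<close> turned by a right angle and normalised. Under
  \<open>bar\<close> it becomes the negative of the normalised \<open>b - a\<close> with its
  coordinates swapped.\<close>

lemma unit_normal_segment: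
  assumes "a \<noteq> (b :: real^2)"
  obtains n where "n \<in> unit_normals (closed_segment a b)"
    "bar n = (1 / norm (b - a)) *\<^sub>R vector [- (b - a)$2, - (b - a)$1]"
proof -
  define d where "d = b - a"
  have d0: "norm d > 0" using assms by (simp add: d_def)
  define n :: "real^2" where "n = (1 / norm d) *\<^sub>R vector [- d$2, d$1]"
  have "n \<bullet> (y - x) = 0" if "x \<in> closed_segment a b" "y \<in> closed_segment a b" for x y
  proof -
    from that obtain k where "y - x = k *\<^sub>R d"
      unfolding d_def by (rule closed_segment_diff)
    moreover have "n \<bullet> d = 0" by (simp add: n_def inner_vec_def sum_2)
    ultimately show ?thesis by simp
  qed
  moreover have "norm n = 1"
  proof -
    have "norm (vector [- d$2, d$1] :: real^2) = norm d"
      by (simp add: norm_vec_def L2_set_def sum_2 add.commute)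
    then show ?thesis using d0 by (simp add: n_def)
  qed
  ultimately have "n \<in> unit_normals (closed_segment a b)" by (auto simp: unit_normals_def)
  then show ?thesis by (rule that) (simp add: n_def d_def bar_def vec_eq_iff forall_2 minus_divide_left)
qed

text \<open>If \<open>bar n = m *\<^sub>R d\<close> for a unit normal \<open>n\<close>,
  orthogonality of \<open>n\<close> and \<open>d\<close> reads
  \<open>m * ((d$1)\<^sup>2 - (d$2)\<^sup>2) = 0\<close> with \<open>m \<noteq> 0\<close>.
  Conversely, swapping the coordinates of a diagonal vector affects at most its sign.\<close>

lemma type_I_segment_iff:
  assumes "a \<noteq> b"
  shows "type_I (closed_segment a b) \<longleftrightarrow> \<bar>(b - a)$1\<bar> = \<bar>(b - a)$2\<bar>"
proof
  define d where "d = b - a"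
  have d0: "d \<noteq> 0" using assms by (simp add: d_def)
  { assume "type_I (closed_segment a b)"
    then obtain n t where n: "n \<in> unit_normals (closed_segment a b)"
      and t: "t \<in> unit_tangents (closed_segment a b)" and nt: "bar n = t \<or> bar n = - t"
      unfolding type_I_def by blast
    obtain x y where xy: "x \<in> closed_segment a b" "y \<in> closed_segment a b" "x \<noteq> y" "t = sgn (y - x)"
      using t unfolding unit_tangents_def by blast
    obtain k where k: "y - x = k *\<^sub>R d" using closed_segment_diff[OF xy(1,2)] unfolding d_def by blast
    have nd: "n$1 * d$1 + n$2 * d$2 = 0" "norm n = 1"
      using n by (auto simp: unit_normals_def d_def inner_vec_def sum_2)
    obtain m where m: "bar n = m *\<^sub>R d"
      using nt unfolding xy(4) k sgn_div_norm by (metis scaleR_minus_left scaleR_scaleR)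
    have n12: "n$1 = m * d$1" "n$2 = - m * d$2"
      using m by (simp_all add: bar_def vec_eq_iff forall_2)
    then have "m \<noteq> 0" using nd(2) by (auto simp: norm_vec_def L2_set_def sum_2)
    have "m * ((d$1)\<^sup>2 - (d$2)\<^sup>2) = 0" using nd(1) unfolding n12 by algebra
    then have "(d$1)\<^sup>2 = (d$2)\<^sup>2" using \<open>m \<noteq> 0\<close> by simp
    then show "\<bar>(b - a)$1\<bar> = \<bar>(b - a)$2\<bar>" by (simp add: d_def power2_eq_iff abs_eq_iff) }
  { assume eq: "\<bar>(b - a)$1\<bar> = \<bar>(b - a)$2\<bar>"
    obtain n where n: "n \<in> unit_normals (closed_segment a b)"
      "bar n = (1 / norm d) *\<^sub>R vector [- d$2, - d$1]"
      using unit_normal_segment[OF assms] unfolding d_def by blast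
    from eq have "d$1 = d$2 \<or> d$1 = - d$2" by (auto simp: d_def abs_eq_iff)
    then have "bar n = sgn d \<or> bar n = - sgn d"
      unfolding n(2) sgn_div_norm vec_eq_iff forall_2
      by (elim disjE) (simp_all add: divide_inverse)
    moreover have "sgn d \<in> unit_tangents (closed_segment a b)"
      unfolding unit_tangents_def d_def using assms by force
    ultimately show "type_I (closed_segment a b)" unfolding type_I_def using n(1) by blast }
qed

section \<open>Triangles with two type I edges\<close>

lemma compl_3: "- {1::3} = {2, 3}" "- {2::3} = {1, 3}" "- {3::3} = {1, 2}"
  using UNIV_3 by auto

lemma opp_edge_simps:
  "opp_edge a 1 = closed_segment (a 2) (a 3)"
  "opp_edge a 2 = closed_segment (a 1) (a 3)"
  "opp_edge a 3 = closed_segment (a 1) (a 2)"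
  by (simp_all add: opp_edge_def compl_3 segment_convex_hull)

lemma labellingI:
  assumes "distinct [p, q, r]" "\<not> affine_dependent {p, q, r}"
    and "type_I (convex hull {q, r})" "type_I (convex hull {p, r})" "type_II (convex hull {p, q})"
  shows "\<exists>a. admissible_labelling (convex hull {p, q, r}) a"
proof -
  define a :: "3 \<Rightarrow> real^2" where "a i = (if i = 1 then p else if i = 2 then q else r)" for i
  have a: "a 1 = p" "a 2 = q" "a 3 = r" by (simp_all add: a_def)
  have "inj a" using assms(1) by (auto simp: inj_def forall_3 a)
  moreover have "range a = {p, q, r}" by (simp add: UNIV_3 a)
  ultimately have "admissible_labelling (convex hull {p, q, r}) a"
    using assms by (simp add: admissible_labelling_def is_vertices_def opp_edge_simps segment_convex_hull a)
  then show ?thesis by blast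
qed

text \<open>Faces of a simplex are hulls of sets of vertices, of dimension one less than their
  number, so edges come from pairs. This links \<open>edge_of\<close>, by which type I edges are
  counted, with the labelled vertices.\<close>

lemma edges_of_triangle:
  assumes "distinct [p, q, r]" "\<not> affine_dependent {p, q, r}"
  shows "e edge_of convex hull {p, q, r} \<longleftrightarrow>
    e \<in> {convex hull {q, r}, convex hull {p, r}, convex hull {p, q}}"
proof -
  have ad: "aff_dim (convex hull c) = int (card c) - 1" if "c \<subseteq> {p, q, r}" for c
    using affine_independent_subset[OF assms(2) that] by (simp add: aff_dim_convex_hull aff_dim_affine_independent)
  have *: "c \<subseteq> {p, q, r} \<and> card c = 2 \<longleftrightarrow> c = {q, r} \<or> c = {p, r} \<or> c = {p, q}" for c
  proof (intro iffI conjI; (elim conjE)?)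
    assume c: "c \<subseteq> {p, q, r}" "card c = 2"
    then have "card ({p, q, r} - c) = 1"
      using assms(1) by (subst card_Diff_subset) (auto intro: finite_subset)
    then obtain s where s: "{p, q, r} - c = {s}" using card_1_singletonE by blast
    then have "c = {p, q, r} - {s}" "s \<in> {p, q, r}" using c(1) by blast+
    then show "c = {q, r} \<or> c = {p, r} \<or> c = {p, q}" using assms(1) by auto
  next
    assume "c = {q, r} \<or> c = {p, r} \<or> c = {p, q}"
    then show "c \<subseteq> {p, q, r}" "card c = 2" using assms(1) by auto
  qed
  have "e edge_of convex hull {p, q, r} \<longleftrightarrow> (\<exists>c. (c \<subseteq> {p, q, r} \<and> card c = 2) \<and> e = convex hull c)"
  proof
    assume "e edge_of convex hull {p, q, r}"
    then obtain c where c: "c \<subseteq> {p, q, r}" "e = convex hull c" "aff_dim e = 1"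
      unfolding edge_of_def face_of_convex_hull_affine_independent[OF assms(2)] by blast
    then have "card c = 2" using ad[OF c(1)] by simp
    with c show "\<exists>c. (c \<subseteq> {p, q, r} \<and> card c = 2) \<and> e = convex hull c" by blast
  next
    assume "\<exists>c. (c \<subseteq> {p, q, r} \<and> card c = 2) \<and> e = convex hull c"
    then obtain c where c: "c \<subseteq> {p, q, r}" "card c = 2" "e = convex hull c" by blast
    then show "e edge_of convex hull {p, q, r}"
      unfolding edge_of_def face_of_convex_hull_affine_independent[OF assms(2)]
      using ad[OF c(1)] by auto
  qed
  then show ?thesis unfolding * by blast
qed

text \<open>Exactly one of the three edges is type II, and the vertex opposite to it becomes
  \<open>a 3\<close>.\<close>

lemma admissible_labelling_exists:
  assumes "2 simplex T" "card {e. e edge_of T \<and> type_I e} = 2"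
  obtains a where "admissible_labelling T a"
proof -
  obtain C where C: "\<not> affine_dependent C" "card C = 3" "T = convex hull C"
    using assms(1) unfolding simplex_def by (auto simp: eq_iff)
  obtain p q r where pqr: "C = {p, q, r}" "distinct [p, q, r]"
    using C(2) by (auto simp: card_3_iff)
  define e1 e2 e3 where "e1 = convex hull {q, r}" and "e2 = convex hull {p, r}" and "e3 = convex hull {p, q}"
  have d: "e1 \<noteq> e2" "e1 \<noteq> e3" "e2 \<noteq> e3"
    using pqr(2) unfolding e1_def e2_def e3_def segment_convex_hull[symmetric] closed_segment_eq
    by (auto simp: doubleton_eq_iff)
  have "{e. e edge_of T \<and> type_I e} = {e \<in> {e1, e2, e3}. type_I e}"
    using edges_of_triangle[OF pqr(2)] C pqr(1) by (auto simp: e1_def e2_def e3_def)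
  then have "card {e \<in> {e1, e2, e3}. type_I e} = 2" using assms(2) by simp
  moreover have "{e \<in> {e1, e2, e3}. type_I e} = (if type_I e1 then {e1} else {}) \<union>
      (if type_I e2 then {e2} else {}) \<union> (if type_I e3 then {e3} else {})" by auto
  ultimately consider "type_I e1" "type_I e2" "type_II e3" | "type_I e1" "type_II e2" "type_I e3"
    | "type_II e1" "type_I e2" "type_I e3"
    using d by (auto split: if_splits)
  then have "\<exists>a. admissible_labelling T a"
  proof cases
    case 1
    with labellingI[of p q r] pqr C show ?thesis by (simp add: e1_def e2_def e3_def)
  next
    case 2
    have "{p, r, q} = {p, q, r}" "{r, q} = {q, r}" by auto
    from labellingI[of p r q, unfolded this] 2 pqr C show ?thesis
      by (auto simp: e1_def e2_def e3_def)
  next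
    case 3
    have "{q, p, r} = {p, q, r}" "{r, p} = {p, r}" "{q, p} = {p, q}" by auto
    from labellingI[of q r p, unfolded this] 3 pqr C show ?thesis
      by (auto simp: e1_def e2_def e3_def)
  qed
  then show ?thesis using that by blast
qed

lemma closed_segment_line:
  assumes "x \<in> closed_segment u w"
  shows "\<exists>t. x = u + t *\<^sub>R (w - u)"
proof -
  obtain t where "x - u = t *\<^sub>R (w - u)"
    using closed_segment_diff[OF ends_in_segment(1) assms] .
  then show ?thesis by (metis add.commute diff_add_cancel)
qed

text \<open>The difference \<open>r\<close> of the two cubics annihilates the degrees of freedom of
  \<open>T\<close> with nodes on the shared edge, and these determine it there. A type I edge is
  parallel to \<open>d\<close>, so that the derivative along \<open>d\<close> is tangential, or
  orthogonal to \<open>d\<close>, and then the condition on \<open>d \<bullet> x\<close> excludes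
  it. On the type II edge all of \<open>grad r\<close> vanishes.\<close>

lemma edge_agreement:
  assumes lab: "admissible_labelling T a" and p: "p \<in> poly_space 3" "q \<in> poly_space 3"
    and dof: "\<And>y L. (y, L) \<in> dofs a \<Longrightarrow> y \<in> T' \<Longrightarrow> L q = L p"
    and e: "opp_edge a i \<subseteq> T'" "x \<in> opp_edge a i"
    and d: "\<bar>d$1\<bar> = \<bar>d$2\<bar>" "d \<noteq> 0"
  shows "q x = p x"
    and "d \<bullet> x \<notin> (\<lambda>v. d \<bullet> v) ` range a \<Longrightarrow> grad q x \<bullet> d = grad p x \<bullet> d"
proof -
  define r where "r y = q y - p y" for y
  have r: "r \<in> poly_space 3" unfolding r_def[abs_def] by (intro poly_space_diff p)
  have gr: "grad r y \<bullet> w = grad q y \<bullet> w - grad p y \<bullet> w" for y w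
    unfolding r_def[abs_def] by (rule grad_diff_inner[OF p(2,1)])
  have va: "r (a j) = 0" if "a j \<in> T'" for j
  proof -
    have "(a j, \<lambda>v. v (a j)) \<in> dofs a" unfolding dofs_def by blast
    from dof[OF this that] show ?thesis by (simp add: r_def)
  qed
  have mi: "r (midpoint (a j) (a 3)) = 0" if "midpoint (a j) (a 3) \<in> T'" "j \<in> {1, 2}" for j
  proof -
    have "(midpoint (a j) (a 3), \<lambda>v. v (midpoint (a j) (a 3))) \<in> dofs a"
      using that unfolding dofs_def by blast
    from dof[OF this that(1)] show ?thesis by (simp add: r_def)
  qed
  have ga: "grad r (a j) \<bullet> (a k - a j) = 0" if "a j \<in> T'" "j \<in> {1, 2}" "k \<noteq> j" for j k
  proof -
    have "(a j, \<lambda>v. grad v (a j) \<bullet> (a k - a j)) \<in> dofs a"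
      using that unfolding dofs_def by blast
    from dof[OF this that(1)] show ?thesis by (simp add: gr)
  qed
  have gm: "grad r (midpoint (a 1) (a 2)) \<bullet> bar n = 0"
    if "midpoint (a 1) (a 2) \<in> T'" "n \<in> unit_normals (opp_edge a 3)" for n
  proof -
    have "(midpoint (a 1) (a 2), \<lambda>v. grad v (midpoint (a 1) (a 2)) \<bullet> bar n) \<in> dofs a"
      using that unfolding dofs_def by blast
    from dof[OF this that(1)] show ?thesis by (simp add: gr)
  qed
  have inj: "inj a" and ind: "\<not> affine_dependent (range a)"
    and types: "type_I (opp_edge a 1)" "type_I (opp_edge a 2)" "type_II (opp_edge a 3)"
    using lab by (auto simp: admissible_labelling_def is_vertices_def)
  have dist: "distinct [a 1, a 2, a 3]" using inj by (auto simp: inj_eq)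
  \<comment> \<open>Two diagonal vectors are parallel or orthogonal. Orthogonality would give
    \<open>d \<bullet> x = d \<bullet> u\<close> for the vertex \<open>u\<close>, which is
    excluded.\<close>
  have tangent: "grad r x \<bullet> d = 0"
    if "type_I (closed_segment u w)" "u \<noteq> w" "x \<in> closed_segment u w" "u \<in> range a"
      "grad r x \<bullet> (w - u) = 0" "d \<bullet> x \<notin> (\<lambda>v. d \<bullet> v) ` range a" for u w
  proof -
    define e where "e = w - u"
    from that(3) obtain t where "x = u + t *\<^sub>R e" using closed_segment_line unfolding e_def by blast
    then have t: "x - u = t *\<^sub>R e" by simp
    have eq: "\<bar>e$1\<bar> = \<bar>e$2\<bar>" using that type_I_segment_iff unfolding e_def by blast
    have d0: "d$1 \<noteq> 0" "d$2 \<noteq> 0" using d by (auto simp: vec_eq_iff forall_2)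
    have w0: "e$1 \<noteq> 0" using eq that(2) by (auto simp: e_def vec_eq_iff forall_2)
    have "d \<bullet> e \<noteq> 0"
    proof
      assume "d \<bullet> e = 0"
      then have "d \<bullet> (x - u) = 0" by (simp add: t)
      then have "d \<bullet> x = d \<bullet> u" by (simp add: inner_diff_right)
      with that show False by auto
    qed
    then have "d$1 * e$1 + d$2 * e$2 \<noteq> 0" by (simp add: inner_vec_def sum_2)
    moreover have "d$1 = d$2 \<or> d$1 = - d$2" "e$1 = e$2 \<or> e$1 = - e$2"
      using d(1) eq by (auto simp: abs_eq_iff)
    ultimately have "d$1 = d$2 \<and> e$1 = e$2 \<or> d$1 = - d$2 \<and> e$1 = - e$2"
      by auto
    then have "d = (d$1 / e$1) *\<^sub>R e"
      using w0 d0 by (auto simp: vec_eq_iff forall_2 field_simps)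
    then show ?thesis using that(5)[folded e_def] by (metis inner_scaleR_right mult_zero_right)
  qed
  have mid: "midpoint u w \<in> T'" "u \<in> T'" "w \<in> T'" if "closed_segment u w \<subseteq> T'" for u w
    using that by auto
  consider "i = 1" | "i = 2" | "i = 3" using exhaust_3 by blast
  then have "r x = 0 \<and> (d \<bullet> x \<notin> (\<lambda>v. d \<bullet> v) ` range a \<longrightarrow> grad r x \<bullet> d = 0)"
  proof cases
    case 1
    note e' = e[unfolded 1 opp_edge_simps] and T' = mid[OF e(1)[unfolded 1 opp_edge_simps]]
    obtain t where t: "x = a 2 + t *\<^sub>R (a 3 - a 2)" using closed_segment_line[OF e'(2)] by blast
    \<comment> \<open>Derivatives are degrees of freedom at \<open>a 1\<close> and
      \<open>a 2\<close> only, so a type I edge is parametrised from that end and not from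
      \<open>a 3\<close>.\<close>
    have z: "r (a 2) = 0" "r (a 3) = 0" "r (midpoint (a 2) (a 3)) = 0" "grad r (a 2) \<bullet> (a 3 - a 2) = 0"
      using T' by (auto intro!: va mi ga)
    show ?thesis
      using cubic_zero_on_midpoint_edge[OF r z, of t] tangent[of "a 2" "a 3"] types(1) dist e'(2)
      by (auto simp: t[symmetric] opp_edge_simps)
  next
    case 2
    note e' = e[unfolded 2 opp_edge_simps] and T' = mid[OF e(1)[unfolded 2 opp_edge_simps]]
    obtain t where t: "x = a 1 + t *\<^sub>R (a 3 - a 1)" using closed_segment_line[OF e'(2)] by blast
    have z: "r (a 1) = 0" "r (a 3) = 0" "r (midpoint (a 1) (a 3)) = 0" "grad r (a 1) \<bullet> (a 3 - a 1) = 0"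
      using T' by (auto intro!: va mi ga)
    show ?thesis
      using cubic_zero_on_midpoint_edge[OF r z, of t] tangent[of "a 1" "a 3"] types(2) dist e'(2)
      by (auto simp: t[symmetric] opp_edge_simps)
  next
    case 3
    note e' = e[unfolded 3 opp_edge_simps] and T' = mid[OF e(1)[unfolded 3 opp_edge_simps]]
    obtain t where t: "x = a 1 + t *\<^sub>R (a 2 - a 1)" using closed_segment_line[OF e'(2)] by blast
    have g: "grad r (a 1) \<bullet> (a 2 - a 1) = 0" "grad r (a 1) \<bullet> (a 3 - a 1) = 0"
      "grad r (a 2) \<bullet> (a 1 - a 2) = 0" "grad r (a 2) \<bullet> (a 3 - a 2) = 0"
      using T' by (auto intro!: ga)
    have ind3: "\<not> affine_dependent {a 1, a 2, a 3}" using ind by (simp add: UNIV_3)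
    \<comment> \<open>The derivatives along the two edges meeting at \<open>a 1\<close> determine
      the full gradient there; likewise at \<open>a 2\<close>.\<close>
    have g1: "grad r (a 1) = 0"
      using not_collinear_det[OF ind3 dist] by (rule real2_indep_zero[OF g(1,2)])
    have g2: "grad r (a 2) = 0"
      using not_collinear_det[of "a 2" "a 1" "a 3"] ind3 dist
      by (intro real2_indep_zero[OF g(3,4)]) (auto simp: insert_commute)
    have z: "r (a 1) = 0" "r (a 2) = 0" "grad r (a 1) \<bullet> (a 2 - a 1) = 0" "grad r (a 2) \<bullet> (a 2 - a 1) = 0"
      using T' g1 g2 by (auto intro!: va)
    note rx = cubic_zero_on_Hermite_edge[OF r z, of t, folded t]
    obtain n where n: "n \<in> unit_normals (opp_edge a 3)"
      "bar n = (1 / norm (a 2 - a 1)) *\<^sub>R vector [- (a 2 - a 1)$2, - (a 2 - a 1)$1]"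
      using unit_normal_segment[of "a 1" "a 2"] dist unfolding opp_edge_simps by auto
    \<comment> \<open>The derivative along \<open>bar n\<close> vanishes at both ends together with
      the gradients, and at the midpoint by the last degree of freedom.\<close>
    have "(\<lambda>y. grad r y \<bullet> bar n) \<in> poly_space 2"
      using r by (intro poly_space_grad_inner) (simp add: numeral_eq_Suc)
    from quadratic_zero_on_edge[OF this, of "a 1" "a 2" t] gm[OF T'(1) n(1)] g1 g2
    have rn: "grad r x \<bullet> bar n = 0" by (simp add: t[symmetric])
    have neq: "\<bar>(a 2 - a 1)$1\<bar> \<noteq> \<bar>(a 2 - a 1)$2\<bar>"
      using types(3) dist unfolding opp_edge_simps by (simp add: type_I_segment_iff)
    have "grad r x = 0"
    proof (rule real2_indep_zero[OF rx(2) rn])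
      \<comment> \<open>Up to scaling, the determinant of the edge vector and \<open>bar n\<close>
        is a difference of squares, nonzero exactly because the edge is type II.\<close>
      have det: "e$1 * (c *\<^sub>R (vector [- e$2, - e$1] :: real^2))$2 - e$2 * (c *\<^sub>R (vector [- e$2, - e$1] :: real^2))$1 =
          c * ((e$2)\<^sup>2 - (e$1)\<^sup>2)" for e :: "real^2" and c
        by (simp add: power2_eq_square algebra_simps)
      have "((a 2 - a 1)$2)\<^sup>2 - ((a 2 - a 1)$1)\<^sup>2 \<noteq> 0"
        using neq by (auto simp: power2_eq_iff abs_eq_iff)
      then have "(1 / norm (a 2 - a 1)) * (((a 2 - a 1)$2)\<^sup>2 - ((a 2 - a 1)$1)\<^sup>2) \<noteq> 0"
        using dist by auto
      then show "(a 2 - a 1)$1 * (bar n)$2 - (a 2 - a 1)$2 * (bar n)$1 \<noteq> 0"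
        unfolding n(2) det .
    qed
    with rx(1) show ?thesis by simp
  qed
  then show "q x = p x" "d \<bullet> x \<notin> (\<lambda>v. d \<bullet> v) ` range a \<Longrightarrow> grad q x \<bullet> d = grad p x \<bullet> d"
    by (auto simp: gr r_def)
qed

section \<open>Conformity of the cubic element\<close>

text \<open>The intersection is a common face, hence the hull of some vertices of \<open>T\<close>;
  it is proper because distinct triangles, having equal dimension, are not faces of each other.
  Without the vertex \<open>i\<close> there remains the whole opposite edge or at most one
  vertex.\<close>

lemma cells_meet_in_edge_or_vertex:
  assumes tr: "T \<inter> T' face_of T" "T \<inter> T' face_of T'" and "T \<noteq> T'"
    and simp: "2 simplex T" "2 simplex T'"
    and vert: "is_vertices T a" and x: "x \<in> T" "x \<in> T'"
  obtains i where "opp_edge a i \<subseteq> T'" "x \<in> opp_edge a i" | i where "x = a i"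
proof -
  have ind: "\<not> affine_dependent (range a)" and T: "T = convex hull (range a)" and "inj a"
    using vert by (auto simp: is_vertices_def)
  obtain c where c: "c \<subseteq> range a" "T \<inter> T' = convex hull c"
    using tr(1) unfolding T face_of_convex_hull_affine_independent[OF ind] by blast
  have "T \<inter> T' \<noteq> T"
  proof
    assume *: "T \<inter> T' = T"
    have "convex T'" using simp(2) by (rule convex_simplex)
    then have "aff_dim T < aff_dim T'" using tr(2) \<open>T \<noteq> T'\<close> unfolding * by (rule face_of_aff_dim_lt)
    then show False using simp by (simp add: aff_dim_simplex)
  qed
  then obtain i where i: "a i \<notin> c" using c T by (metis image_subset_iff subset_antisym)
  then have ci: "c \<subseteq> a ` (- {i})" using c by auto
  have xc: "x \<in> convex hull c" using x c by auto
  show ?thesis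
  proof (cases "c = a ` (- {i})")
    case True
    then show ?thesis using c xc by (intro that(1)[of i]) (auto simp: opp_edge_def)
  next
    case False
    then obtain k where "k \<noteq> i" "a k \<notin> c" using ci by blast
    obtain j where "\<And>m. m = i \<or> m = k \<or> m = j"
      using \<open>k \<noteq> i\<close> by (metis exhaust_3)
    then have "c \<subseteq> {a j}" using ci \<open>a k \<notin> c\<close> by blast
    then have "x = a j" using xc hull_mono[of c "{a j}" convex] by auto
    then show ?thesis by (rule that(2))
  qed
qed

section \<open>Test functions and the wave operator\<close>

lemma grad_zero_outside_closed:
  assumes "closed S" "\<And>y. y \<notin> S \<Longrightarrow> f y = 0" "x \<notin> S"
  shows "grad f x \<bullet> d = 0"
proof -
  have "(f has_derivative (\<lambda>h. 0)) (at x)"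
  proof (rule has_derivative_transform_within_open)
    show "((\<lambda>x. 0) has_derivative (\<lambda>h. 0)) (at x)" by simp
    show "open (- S)" using assms(1) by auto
  qed (use assms in auto)
  then show ?thesis by (simp add: grad_inner_eq partial_eqI)
qed

lemma test_functions_C_k: "\<phi> \<in> test_functions \<Omega> \<Longrightarrow> C_k k \<phi>"
  by (simp add: test_functions_def)

text \<open>The support is closed and contained in \<Omega>, so near a point off \<Omega> the
  function and with it all derivatives vanish.\<close>

lemma test_functions_zero:
  assumes "\<phi> \<in> test_functions \<Omega>" "x \<notin> \<Omega>"
  shows "\<phi> x = 0" "grad \<phi> x \<bullet> d = 0" "grad (\<lambda>y. grad \<phi> y \<bullet> d) x \<bullet> d' = 0"
proof -
  define S where "S = closure {x. \<phi> x \<noteq> 0}"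
  have S: "closed S" "x \<notin> S" using assms by (auto simp: test_functions_def S_def)
  have 0: "\<phi> y = 0" if "y \<notin> S" for y
    using that closure_subset[of "{x. \<phi> x \<noteq> 0}"] by (auto simp: S_def)
  have 1: "grad \<phi> y \<bullet> d = 0" if "y \<notin> S" for y d
    by (rule grad_zero_outside_closed[OF S(1) 0 that])
  show "grad (\<lambda>y. grad \<phi> y \<bullet> d) x \<bullet> d' = 0"
    by (rule grad_zero_outside_closed[OF S(1) 1 S(2)])
  show "\<phi> x = 0" "grad \<phi> x \<bullet> d = 0" using 0 1 S(2) by blast+
qed

text \<open>The wave operator in its characteristic directions. Averaging the two orders of
  differentiation makes each of the two mixed second derivatives cancel separately.\<close>

lemma box_op_eq:
  assumes "C_k (Suc (Suc 0)) f"
  shows "box_op f x = (1 / 2) * (grad (\<lambda>y. grad f y \<bullet> vector [1, -1]) x \<bullet> vector [1, 1]) +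
    (1 / 2) * (grad (\<lambda>y. grad f y \<bullet> vector [1, 1]) x \<bullet> vector [1, -1])"
proof -
  have "partial i f differentiable (at x)" for i using assms by simp
  note lincomb = partial_lincomb[OF this this]
  show ?thesis
    unfolding grad_inner_eq lincomb box_op_def by (simp add: field_simps)
qed

section \<open>Square integrability and integrals of piecewise functions\<close>

context convex_cells
begin

lemma pw_power2:
  assumes "x \<notin> (\<Union>T\<in>\<T>. frontier T)"
  shows "(pw \<T> f x)\<^sup>2 = pw \<T> (\<lambda>T x. (f T x)\<^sup>2) x"
proof (cases "x \<in> \<Union>\<T>")
  case True
  then obtain T where T: "T \<in> \<T>" "x \<in> T" by blast
  then have "x \<in> interior T" using assms by (auto simp: frontier_def closure_def)
  with T show ?thesis by (simp add: pw_interior)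
qed (simp add: pw_outside)

text \<open>A bridge from integrals over \<open>lebesgue_on \<Omega>\<close> of a function known
  only off the skeleton to integrals of the Borel function \<open>pw \<T> f\<close> over the
  plane.\<close>

lemma
  assumes u: "\<And>x. x \<in> \<Omega> \<Longrightarrow> x \<notin> (\<Union>T\<in>\<T>. frontier T) \<Longrightarrow> u x = pw \<T> f x"
    and f: "\<And>T. T \<in> \<T> \<Longrightarrow> continuous_on UNIV (f T)"
  shows pw_in_L2: "u \<in> L2 \<Omega>"
    and integral_eq_pw: "\<And>\<rho>. continuous_on UNIV \<rho> \<Longrightarrow> (\<And>x. x \<notin> \<Omega> \<Longrightarrow> \<rho> x = 0) \<Longrightarrow>
      (LINT x|lebesgue_on \<Omega>. u x * \<rho> x) = (\<integral>x. pw \<T> f x * \<rho> x \<partial>lborel)"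
proof -
  have \<Omega>[measurable]: "\<Omega> \<in> sets lebesgue" "\<Omega> \<in> sets borel" using opn by auto
  have ae: "AE x in lebesgue. indicator \<Omega> x * pw \<T> f x = indicator \<Omega> x * u x"
    using AE_completion[OF AE_not_skeleton[of 0]] by eventually_elim (auto simp: u indicator_def)
  have m: "pw \<T> f \<in> borel_measurable borel" using borel_measurable_integrable[OF pw_integrable[OF f]] by simp
  then have "(\<lambda>x. indicator \<Omega> x * pw \<T> f x) \<in> borel_measurable lebesgue"
    by (intro measurable_completion) (simp add: \<Omega>)
  \<comment> \<open>On the skeleton \<open>u\<close> is arbitrary, so its measurability rests on the
    completeness of Lebesgue measure.\<close>
  then have um: "(\<lambda>x. indicator \<Omega> x * u x) \<in> borel_measurable lebesgue"
    using ae by (rule borel_measurable_AE)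
  have um': "u \<in> borel_measurable (lebesgue_on \<Omega>)"
    using um by (subst borel_measurable_restrict_space_iff) (auto simp: mult.commute)
  have "integrable lebesgue (\<lambda>x. indicator \<Omega> x *\<^sub>R (u x)\<^sup>2)"
  proof (rule Bochner_Integration.integrable_bound)
    have "integrable lborel (pw \<T> (\<lambda>T x. (f T x)\<^sup>2))"
      using f by (intro pw_integrable continuous_on_power)
    then show "integrable lebesgue (pw \<T> (\<lambda>T x. (f T x)\<^sup>2))"
      by (subst integrable_completion) auto
    have "(\<lambda>x. (indicator \<Omega> x * u x)\<^sup>2) \<in> borel_measurable lebesgue"
      using um by measurable
    moreover have "(\<lambda>x. (indicator \<Omega> x * u x)\<^sup>2) = (\<lambda>x. indicator \<Omega> x *\<^sub>R (u x)\<^sup>2)"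
      by (auto simp: indicator_def)
    ultimately show "(\<lambda>x. indicator \<Omega> x *\<^sub>R (u x)\<^sup>2) \<in> borel_measurable lebesgue" by simp
    show "AE x in lebesgue. norm (indicator \<Omega> x *\<^sub>R (u x)\<^sup>2) \<le> norm (pw \<T> (\<lambda>T x. (f T x)\<^sup>2) x)"
      using AE_completion[OF AE_not_skeleton[of 0]]
      by eventually_elim (auto simp: u indicator_def pw_power2)
  qed
  then have "integrable (lebesgue_on \<Omega>) (\<lambda>x. (u x)\<^sup>2)"
    by (subst integrable_restrict_space) auto
  with um' show "u \<in> L2 \<Omega>" by (simp add: L2_def)
  fix \<rho> :: "real^2 \<Rightarrow> real"
  assume \<rho>: "continuous_on UNIV \<rho>" "\<And>x. x \<notin> \<Omega> \<Longrightarrow> \<rho> x = 0"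
  have r: "\<rho> \<in> borel_measurable borel" using \<rho>(1) by (rule borel_measurable_continuous_onI)
  then have r': "\<rho> \<in> borel_measurable lebesgue" by (intro measurable_completion) simp
  have "(LINT x|lebesgue_on \<Omega>. u x * \<rho> x) = (LINT x|lebesgue. indicator \<Omega> x *\<^sub>R (u x * \<rho> x))"
    by (rule integral_restrict_space) simp
  also have "\<dots> = (LINT x|lebesgue. (indicator \<Omega> x * u x) * \<rho> x)"
    by (simp add: mult.assoc)
  also have "\<dots> = (LINT x|lebesgue. pw \<T> f x * \<rho> x)"
  proof (rule integral_cong_AE)
    show "(\<lambda>x. (indicator \<Omega> x * u x) * \<rho> x) \<in> borel_measurable lebesgue"
      using um r' by (rule borel_measurable_times)
    show "(\<lambda>x. pw \<T> f x * \<rho> x) \<in> borel_measurable lebesgue"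
      using m r by (intro measurable_completion borel_measurable_times) simp_all
    show "AE x in lebesgue. (indicator \<Omega> x * u x) * \<rho> x = pw \<T> f x * \<rho> x"
      using ae by eventually_elim (use \<rho>(2) in \<open>auto simp: indicator_def split: if_splits\<close>)
  qed
  also have "\<dots> = (\<integral>x. pw \<T> f x * \<rho> x \<partial>lborel)"
    using m r by (intro integral_completion borel_measurable_times) simp_all
  finally show "(LINT x|lebesgue_on \<Omega>. u x * \<rho> x) = (\<integral>x. pw \<T> f x * \<rho> x \<partial>lborel)" .
qed

end

lemma axis_inner_partial: "grad f x \<bullet> axis i 1 = partial i f x"
  by (simp add: grad_def inner_axis)

lemma triangulation_faces:
  assumes "triangulation \<T>" "T \<in> \<T>" "T' \<in> \<T>"
  shows "T \<inter> T' face_of T" "T \<inter> T' face_of T'"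
proof -
  have *: "T \<inter> T' face_of T" if "T \<in> \<T>" "T' \<in> \<T>" for T T'
    using assms(1) that unfolding triangulation_def by blast
  show "T \<inter> T' face_of T" "T \<inter> T' face_of T'"
    using *[OF assms(2,3)] *[OF assms(3,2)] by (simp_all add: Int_commute)
qed

text \<open>A proper face of \<open>T\<close> misses the interior of \<open>T\<close>. An overlap
  there would thus make \<open>T\<close> a face of \<open>T'\<close>, impossible for distinct
  triangles of equal dimension.\<close>

lemma triangulation_convex_cells:
  assumes "open \<Omega>" "triangulation_of \<Omega> \<T>"
  shows "convex_cells \<T> \<Omega>"
proof
  have tr: "triangulation \<T>" "\<And>T. T \<in> \<T> \<Longrightarrow> 2 simplex T" "\<Union>\<T> = closure \<Omega>"
    using assms(2) by (auto simp: triangulation_of_def)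
  show "finite \<T>" using tr(1) by (simp add: triangulation_def)
  show "compact T" "convex T" if "T \<in> \<T>" for T
    using tr(2)[OF that] by (auto intro: compact_simplex convex_simplex)
  show "interior T \<inter> T' = {}" if "T \<in> \<T>" "T' \<in> \<T>" "T \<noteq> T'" for T T'
  proof (rule ccontr)
    assume ne: "interior T \<inter> T' \<noteq> {}"
    have f: "T \<inter> T' face_of T" "T \<inter> T' face_of T'"
      using triangulation_faces[OF tr(1) that(1,2)] .
    have "T \<inter> T' = T"
    proof (rule ccontr)
      assume "T \<inter> T' \<noteq> T"
      from face_of_disjoint_interior[OF f(1) this] ne show False
        using interior_subset[of T] by blast
    qed
    then have "T face_of T'" using f(2) by simp
    moreover have "convex T'" using tr(2)[OF that(2)] by (rule convex_simplex)
    ultimately have "aff_dim T < aff_dim T'" using that(3) face_of_aff_dim_lt by blast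
    then show False
      using aff_dim_simplex[OF tr(2)[OF that(1)]] aff_dim_simplex[OF tr(2)[OF that(2)]] by simp
  qed
  show "open \<Omega>" by fact
  show "\<Omega> \<subseteq> \<Union>\<T>" using tr(3) closure_subset by simp
qed

text \<open>
  The excluded points lie on finitely many lines orthogonal to \<open>d\<close>: they cover the vertices, where
  gradients may jump, and the type I edges orthogonal to \<open>d\<close>, across which \<open>\<partial>\<^sub>d\<close> is a normal derivative.
\<close>

lemma V3h_agreement:
  assumes tr: "triangulation_of \<Omega> \<T>"
    and lab: "\<And>T. T \<in> \<T> \<Longrightarrow> admissible_labelling T (a T)"
    and P: "\<And>T. T \<in> \<T> \<Longrightarrow> P T \<in> poly_space 3"
    and dof: "\<And>T b p L T'. T \<in> \<T> \<Longrightarrow> admissible_labelling T b \<Longrightarrow> (p, L) \<in> dofs b \<Longrightarrow> T' \<in> \<T> \<Longrightarrow>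
      p \<in> T' \<Longrightarrow> L (P T') = L (P T)"
    and T: "T \<in> \<T>" "T' \<in> \<T>" "x \<in> T" "x \<in> T'"
    and d: "\<bar>d$1\<bar> = \<bar>d$2\<bar>" "d \<noteq> 0"
  shows "P T x = P T' x"
    and "d \<bullet> x \<notin> (\<lambda>v. d \<bullet> v) ` (\<Union>T\<in>\<T>. range (a T)) \<Longrightarrow> grad (P T) x \<bullet> d = grad (P T') x \<bullet> d"
proof -
  have "P T' x = P T x \<and> (d \<bullet> x \<notin> (\<lambda>v. d \<bullet> v) ` (\<Union>T\<in>\<T>. range (a T)) \<longrightarrow>
      grad (P T') x \<bullet> d = grad (P T) x \<bullet> d)"
  proof (cases "T = T'")
    case False
    note lab' = lab[OF T(1)]
    have f: "T \<inter> T' face_of T" "T \<inter> T' face_of T'" and s: "2 simplex T" "2 simplex T'"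
      using tr T triangulation_faces[of \<T> T T'] by (auto simp: triangulation_of_def)
    have v: "is_vertices T (a T)" using lab' by (simp add: admissible_labelling_def)
    have dof': "L (P T') = L (P T)" if "(y, L) \<in> dofs (a T)" "y \<in> T'" for y L
      using dof[OF T(1) lab' that(1) T(2) that(2)] .
    from f False s v T(3,4) show ?thesis
    proof (cases rule: cells_meet_in_edge_or_vertex)
      case (1 i)
      have "(\<lambda>v. d \<bullet> v) ` range (a T) \<subseteq> (\<lambda>v. d \<bullet> v) ` (\<Union>T\<in>\<T>. range (a T))" using T(1) by blast
      then have *: "d \<bullet> x \<notin> (\<lambda>v. d \<bullet> v) ` range (a T)"
        if "d \<bullet> x \<notin> (\<lambda>v. d \<bullet> v) ` (\<Union>T\<in>\<T>. range (a T))"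
        using that by blast
      show ?thesis
      proof (intro conjI impI)
        show "P T' x = P T x"
          by (rule edge_agreement(1)[OF lab' P[OF T(1)] P[OF T(2)] _ 1 d]) (rule dof')
        show "grad (P T') x \<bullet> d = grad (P T) x \<bullet> d"
          if "d \<bullet> x \<notin> (\<lambda>v. d \<bullet> v) ` (\<Union>T\<in>\<T>. range (a T))"
          by (rule edge_agreement(2)[OF lab' P[OF T(1)] P[OF T(2)] _ 1 d *[OF that]]) (rule dof')
      qed
    next
      case (2 i)
      \<comment> \<open>At a vertex only the values are compared: \<open>d \<bullet> x\<close> is
        then an excluded value and the gradient claim is vacuous.\<close>
      have "(a T i, \<lambda>v. v (a T i)) \<in> dofs (a T)" unfolding dofs_def by blast
      from dof'[OF this] 2 T have "P T' x = P T x" by simp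
      moreover have "d \<bullet> x \<in> (\<lambda>v. d \<bullet> v) ` (\<Union>T\<in>\<T>. range (a T))" using 2 T(1) by blast
      ultimately show ?thesis by blast
    qed
  qed simp
  then show "P T x = P T' x"
    "d \<bullet> x \<notin> (\<lambda>v. d \<bullet> v) ` (\<Union>T\<in>\<T>. range (a T)) \<Longrightarrow> grad (P T) x \<bullet> d = grad (P T') x \<bullet> d"
    by simp_all
qed

theorem theorem3p6:
  fixes \<Omega> :: "(real^2) set" and \<T> :: "(real^2) set set" and \<sigma> :: real
  assumes "open \<Omega>" and "connected \<Omega>" and "\<Omega> \<noteq> {}" and "bounded \<Omega>"
    and "triangulation_of \<Omega> \<T>"
    and "quasi_uniform \<sigma> \<T>"
    and "\<And>T. T \<in> \<T> \<Longrightarrow> card {e. e edge_of T \<and> type_I e} = 2"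
  shows "V3h \<T> \<subseteq> V_space \<Omega>"
proof
  fix v assume "v \<in> V3h \<T>"
  then obtain P where P: "\<And>T. T \<in> \<T> \<Longrightarrow> P T \<in> poly_space 3"
    and v: "\<And>T x. T \<in> \<T> \<Longrightarrow> x \<in> interior T \<Longrightarrow> v x = P T x"
    and dof: "\<And>T b p L T'. T \<in> \<T> \<Longrightarrow> admissible_labelling T b \<Longrightarrow> (p, L) \<in> dofs b \<Longrightarrow> T' \<in> \<T> \<Longrightarrow>
      p \<in> T' \<Longrightarrow> L (P T') = L (P T)"
    unfolding V3h_def by fast
  interpret convex_cells \<T> \<Omega> by (rule triangulation_convex_cells) fact+
  have simp: "2 simplex T" if "T \<in> \<T>" for T using assms(5) that by (simp add: triangulation_of_def)
  have "\<forall>T\<in>\<T>. \<exists>a. admissible_labelling T a"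
    using admissible_labelling_exists[OF simp assms(7)] by metis
  then obtain a where lab: "\<And>T. T \<in> \<T> \<Longrightarrow> admissible_labelling T (a T)" by metis
  \<comment> \<open>The finitely many values of \<open>d \<bullet> y\<close> on the mesh vertices
    mark the lines orthogonal to \<open>d\<close> on which derivatives along \<open>d\<close> may
    jump.\<close>
  define W where "W = (\<Union>T\<in>\<T>. range (a T))"
  have W: "finite ((\<lambda>y. d \<bullet> y) ` W)" for d unfolding W_def using fin by auto
  \<comment> \<open>Any diagonal vector can instantiate \<open>d\<close> for the matching of
    values.\<close>
  have cont: "P T x = P T' x" if "T \<in> \<T>" "T' \<in> \<T>" "x \<in> T" "x \<in> T'" for T T' x
    by (rule V3h_agreement(1)[where P = P and a = a and d = "vector [1, 1]", OF assms(5)])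
      (fact | simp add: vec_eq_iff forall_2)+
  have agree: "grad (P T) x \<bullet> d = grad (P T') x \<bullet> d"
    if "T \<in> \<T>" "T' \<in> \<T>" "x \<in> T" "x \<in> T'" "\<bar>d$1\<bar> = \<bar>d$2\<bar>" "d \<noteq> 0" "d \<bullet> x \<notin> (\<lambda>y. d \<bullet> y) ` W" for T T' x d
    by (rule V3h_agreement(2)[where P = P and a = a, OF assms(5), folded W_def]; fact)
  have smooth: "C_k n (P T)" if "T \<in> \<T>" for n T using P[OF that] by (rule poly_space_C_k)
  have smooth': "C_k n (\<lambda>x. grad (P T) x \<bullet> d)" if "T \<in> \<T>" for n T d
    using smooth[OF that] by (rule C_k_grad_inner)
  have smooth'': "C_k n (\<lambda>x. grad (\<lambda>y. grad (P T) y \<bullet> d) x \<bullet> d')" if "T \<in> \<T>" for n T d d'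
    using smooth'[OF that] by (rule C_k_grad_inner)
  define D1 D2 :: "real^2" where "D1 = vector [1, 1]" and "D2 = vector [1, -1]"
  have D: "\<bar>D1$1\<bar> = \<bar>D1$2\<bar>" "D1 \<noteq> 0" "\<bar>D2$1\<bar> = \<bar>D2$2\<bar>" "D2 \<noteq> 0" "D1 \<bullet> D2 = 0" "D2 \<bullet> D1 = 0"
    by (auto simp: D1_def D2_def vec_eq_iff forall_2 inner_vec_def sum_2)
  have vP: "v x = pw \<T> P x" if "x \<in> \<Omega>" "x \<notin> (\<Union>T\<in>\<T>. frontier T)" for x
  proof -
    from that(1) obtain T where T: "T \<in> \<T>" "x \<in> T" using cover by blast
    then have "x \<in> interior T" using that(2) by (auto simp: frontier_def closure_def)
    then show ?thesis using T v pw_interior by simp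
  qed
  have Pc: "continuous_on UNIV (P T)" if "T \<in> \<T>" for T
    using smooth[OF that] by (rule C_k_continuous)
  have c': "continuous_on UNIV (\<lambda>x. grad (P T) x \<bullet> d)" if "T \<in> \<T>" for T d
    using smooth'[OF that] by (rule C_k_continuous)
  have c'': "continuous_on UNIV (\<lambda>x. grad (\<lambda>y. grad (P T) y \<bullet> d) x \<bullet> d')" if "T \<in> \<T>" for T d d'
    using smooth''[OF that] by (rule C_k_continuous)
  have first: "(\<integral>x. pw \<T> P x * (grad \<psi> x \<bullet> d) \<partial>lborel) =
      - (\<integral>x. pw \<T> (\<lambda>T x. grad (P T) x \<bullet> d) x * \<psi> x \<partial>lborel)"
    if "C_k (Suc 0) \<psi>" "\<And>x. x \<notin> \<Omega> \<Longrightarrow> \<psi> x = 0" for \<psi> d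
  proof -
    \<comment> \<open>Any nonzero normal of \<open>d\<close> will do, hence the default axis for
      \<open>d = 0\<close>. With \<open>A = {}\<close> no line is excluded, as the values match
      everywhere.\<close>
    define l :: "real^2" where "l = (if d = 0 then axis 1 1 else vector [- d$2, d$1])"
    have "l \<noteq> 0" "l \<bullet> d = 0"
      by (auto simp: l_def vec_eq_iff forall_2 inner_vec_def sum_2 axis_def)
    then show ?thesis
      by (intro pw_integration_by_parts[where A = "{}" and l = l] smooth that cont) auto
  qed
  have "\<exists>g\<in>L2 \<Omega>. weak_partial \<Omega> i v g" for i
  proof (intro bexI)
    \<comment> \<open>The weak derivative is the piecewise classical one.\<close>
    let ?g = "pw \<T> (\<lambda>T x. grad (P T) x \<bullet> axis i 1)"
    show "?g \<in> L2 \<Omega>" by (rule pw_in_L2[OF refl c'])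
    show "weak_partial \<Omega> i v ?g"
      unfolding weak_partial_def
    proof
      fix \<phi> assume \<phi>: "\<phi> \<in> test_functions \<Omega>"
      have "(LINT x|lebesgue_on \<Omega>. v x * (grad \<phi> x \<bullet> axis i 1)) = (\<integral>x. pw \<T> P x * (grad \<phi> x \<bullet> axis i 1) \<partial>lborel)"
        using \<phi> by (intro integral_eq_pw[OF vP Pc] test_functions_zero(2) C_k_continuous[of 0] C_k_grad_inner
          test_functions_C_k)
      also have "\<dots> = - (\<integral>x. ?g x * \<phi> x \<partial>lborel)"
        using \<phi> by (intro first test_functions_zero(1) test_functions_C_k)
      also have "(\<integral>x. ?g x * \<phi> x \<partial>lborel) = (LINT x|lebesgue_on \<Omega>. ?g x * \<phi> x)"
        using \<phi> by (intro integral_eq_pw[OF refl c', symmetric] test_functions_zero(1)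
          C_k_continuous[of 0] test_functions_C_k)
      finally show "(LINT x|lebesgue_on \<Omega>. v x * partial i \<phi> x) = - (LINT x|lebesgue_on \<Omega>. ?g x * \<phi> x)"
        unfolding axis_inner_partial .
    qed
  qed
  moreover have "v \<in> L2 \<Omega>" by (rule pw_in_L2[OF vP Pc])
  ultimately have "v \<in> H1 \<Omega>" by (simp add: H1_def)
  \<comment> \<open>Here \<open>d\<close> has two roles: the pieces are first differentiated along
    it, and it is the normal \<open>l\<close> of the lines along which the second integration by
    parts, in direction \<open>d'\<close>, takes place. On all but finitely many of these lines the
    derivatives along \<open>d\<close> match.\<close>
  have second: "(\<integral>x. pw \<T> P x * (grad (\<lambda>y. grad \<phi> y \<bullet> d') x \<bullet> d) \<partial>lborel) =
      (\<integral>x. pw \<T> (\<lambda>T x. grad (\<lambda>y. grad (P T) y \<bullet> d) x \<bullet> d') x * \<phi> x \<partial>lborel)"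
    if \<phi>: "\<phi> \<in> test_functions \<Omega>" and d: "\<bar>d$1\<bar> = \<bar>d$2\<bar>" "d \<noteq> 0" "d \<bullet> d' = 0" for \<phi> d d'
  proof -
    have "(\<integral>x. pw \<T> P x * (grad (\<lambda>y. grad \<phi> y \<bullet> d') x \<bullet> d) \<partial>lborel) =
        - (\<integral>x. pw \<T> (\<lambda>T x. grad (P T) x \<bullet> d) x * (grad \<phi> x \<bullet> d') \<partial>lborel)"
      using \<phi> by (intro first test_functions_zero(2) C_k_grad_inner test_functions_C_k)
    also have "(\<integral>x. pw \<T> (\<lambda>T x. grad (P T) x \<bullet> d) x * (grad \<phi> x \<bullet> d') \<partial>lborel) =
        - (\<integral>x. pw \<T> (\<lambda>T x. grad (\<lambda>y. grad (P T) y \<bullet> d) x \<bullet> d') x * \<phi> x \<partial>lborel)"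
    proof (rule pw_integration_by_parts[OF _ _ _ d(2,3) W[of d]])
      show "grad (P T) x \<bullet> d = grad (P T') x \<bullet> d"
        if "T \<in> \<T>" "T' \<in> \<T>" "x \<in> T" "x \<in> T'" "d \<bullet> x \<notin> (\<lambda>y. d \<bullet> y) ` W" for T T' x
        by (rule agree[OF that(1-4) d(1,2) that(5)])
    qed (use \<phi> smooth' test_functions_C_k test_functions_zero(1) in \<open>blast+\<close>)
    finally show ?thesis by simp
  qed
  \<comment> \<open>The order of directions is opposite to that in \<open>b1\<close> and
    \<open>b2\<close> below, since the outer derivative of the test function is the first to be
    moved.\<close>
  define w1 where "w1 = (\<lambda>T x. grad (\<lambda>y. grad (P T) y \<bullet> D1) x \<bullet> D2)"
  define w2 where "w2 = (\<lambda>T x. grad (\<lambda>y. grad (P T) y \<bullet> D2) x \<bullet> D1)"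
  define w where "w = (\<lambda>T x. (1 / 2) * w1 T x + (1 / 2) * w2 T x)"
  have wc: "continuous_on UNIV (w1 T)" "continuous_on UNIV (w2 T)" "continuous_on UNIV (w T)" if "T \<in> \<T>" for T
    unfolding w_def w1_def w2_def by (intro c''[OF that] continuous_on_add continuous_on_mult_left)+
  have "weak_box \<Omega> v (pw \<T> w)"
    unfolding weak_box_def
  proof
    fix \<phi> assume \<phi>: "\<phi> \<in> test_functions \<Omega>"
    define b1 where "b1 x = grad (\<lambda>y. grad \<phi> y \<bullet> D2) x \<bullet> D1" for x
    define b2 where "b2 x = grad (\<lambda>y. grad \<phi> y \<bullet> D1) x \<bullet> D2" for x
    have box: "box_op \<phi> x = (1 / 2) * b1 x + (1 / 2) * b2 x" for x
      unfolding b1_def b2_def D1_def D2_def by (rule box_op_eq[OF test_functions_C_k[OF \<phi>]])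
    have bc: "continuous_on UNIV b1" "continuous_on UNIV b2"
      unfolding b1_def[abs_def] b2_def[abs_def]
      by (intro C_k_continuous[of 0] C_k_grad_inner test_functions_C_k[OF \<phi>])+
    have \<phi>c: "continuous_on UNIV \<phi>" using test_functions_C_k[OF \<phi>] by (rule C_k_continuous)
    have bz: "b1 x = 0" "b2 x = 0" if "x \<notin> \<Omega>" for x
      unfolding b1_def b2_def by (rule test_functions_zero(3)[OF \<phi> that])+
    have "(LINT x|lebesgue_on \<Omega>. v x * box_op \<phi> x) = (\<integral>x. pw \<T> P x * box_op \<phi> x \<partial>lborel)"
      unfolding box by (intro integral_eq_pw[OF vP Pc] continuous_intros bc) (simp_all add: bz)
    also have "\<dots> = (\<integral>x. (1 / 2) * (pw \<T> P x * b1 x) + (1 / 2) * (pw \<T> P x * b2 x) \<partial>lborel)"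
      unfolding box by (simp add: algebra_simps)
    also have "\<dots> = (1 / 2) * (\<integral>x. pw \<T> P x * b1 x \<partial>lborel) + (1 / 2) * (\<integral>x. pw \<T> P x * b2 x \<partial>lborel)"
      using pw_mult_integrable[OF Pc bc(1)] pw_mult_integrable[OF Pc bc(2)]
      by (simp add: Bochner_Integration.integral_add)
    also have "\<dots> = (1 / 2) * (\<integral>x. pw \<T> w1 x * \<phi> x \<partial>lborel) + (1 / 2) * (\<integral>x. pw \<T> w2 x * \<phi> x \<partial>lborel)"
      unfolding b1_def b2_def w1_def w2_def
      by (simp only: second[OF \<phi> D(1,2,5)] second[OF \<phi> D(3,4,6)])
    also have "\<dots> = (\<integral>x. (1 / 2) * (pw \<T> w1 x * \<phi> x) + (1 / 2) * (pw \<T> w2 x * \<phi> x) \<partial>lborel)"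
      using pw_mult_integrable[OF wc(1) \<phi>c] pw_mult_integrable[OF wc(2) \<phi>c]
      by (simp add: Bochner_Integration.integral_add)
    also have "\<dots> = (\<integral>x. pw \<T> w x * \<phi> x \<partial>lborel)"
      by (simp add: w_def pw_def distrib_left distrib_right sum.distrib sum_distrib_left sum_distrib_right mult_ac)
    also have "\<dots> = (LINT x|lebesgue_on \<Omega>. pw \<T> w x * \<phi> x)"
      by (intro integral_eq_pw[OF refl wc(3), symmetric] \<phi>c test_functions_zero(1)[OF \<phi>])
    finally show "(LINT x|lebesgue_on \<Omega>. v x * box_op \<phi> x) = (LINT x|lebesgue_on \<Omega>. pw \<T> w x * \<phi> x)" .
  qed
  moreover have "pw \<T> w \<in> L2 \<Omega>" by (rule pw_in_L2[OF refl wc(3)])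
  ultimately show "v \<in> V_space \<Omega>" using \<open>v \<in> H1 \<Omega>\<close> by (auto simp: V_space_def)
qed

end
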